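(* The space $\mathscr{T}$, with the topology induced by the Gromov--Hausdorff distance, is path-connected, and every non-empty open subset of $\mathscr{T}$ has infinite topological dimension.
   Context: Geodesic segments: for a metric space $(X,d)$ and $x,y\in X$, a subset $S\subset X$ is a geodesic segment connecting $x$ and $y$ if there are a closed interval $[a,b]\subset\mathbb{R}$ and an isometric embedding $f:[a,b]\to X$ with $f(a)=x$, $f(b)=y$ and $S=f([a,b])$. A geodesic space is a metric space in which every two points are connected by a geodesic segment. Metric tree ($\mathbb{R}$-tree): a geodesic space $(X,d)$ such that for all distinct $x,y,z\in X$ and all geodesic segments $G_1$ connecting $x$ and $y$ and $G_2$ connecting $y$ and $z$ with $G_1\cap G_2=\{y\}$, the union $G_1\cup G_2$ is a geodesic segment connecting $x$ and $z$. Gromov--Hausdorff space: $\mathscr{M}$ is the set of all isometry classes of non-empty compact metric spaces, equipped with the Gromov--Hausdorff distance $\mathcal{GH}$, where $\mathcal{GH}((X,d),(Y,e))$ is the infimum of the Hausdorff distances between $i(X)$ and $j(Y)$ in $(Z,h)$ over all metric spaces $(Z,h)$ and isometric embeddings $i:X\to Z$, $j:Y\to Z$. $\mathscr{T}\subset\mathscr{M}$ is the subset of all (isometry classes of) metric trees. Topological dimension means covering dimension. *)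

theory Defs
  imports "HOL-Analysis.Analysis"
begin

section \<open>Isometries and geodesics\<close>

definition isometric_embedding :: "'a metric \<Rightarrow> 'b metric \<Rightarrow> ('a \<Rightarrow> 'b) \<Rightarrow> bool" where
  "isometric_embedding m m' f \<longleftrightarrow>
     f \<in> mspace m \<rightarrow> mspace m' \<and>
     (\<forall>x\<in>mspace m. \<forall>y\<in>mspace m. mdist m' (f x) (f y) = mdist m x y)"

definition isometric :: "'a metric \<Rightarrow> 'b metric \<Rightarrow> bool" where
  "isometric m m' \<longleftrightarrow> (\<exists>f. isometric_embedding m m' f \<and> f ` mspace m = mspace m')"

text \<open>The interval may be degenerate, so that \<open>{x}\<close> connects \<open>x\<close> to itself.\<close>

definition geodesic_segment :: "'a metric \<Rightarrow> 'a \<Rightarrow> 'a \<Rightarrow> 'a set \<Rightarrow> bool" where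
  "geodesic_segment m x y S \<longleftrightarrow>
     (\<exists>a b. a \<le> b \<and>
        (\<exists>f. isometric_embedding (submetric euclidean_metric {a..b :: real}) m f \<and>
             f a = x \<and> f b = y \<and> S = f ` {a..b}))"

definition geodesic_space :: "'a metric \<Rightarrow> bool" where
  "geodesic_space m \<longleftrightarrow> (\<forall>x\<in>mspace m. \<forall>y\<in>mspace m. \<exists>S. geodesic_segment m x y S)"

definition metric_tree :: "'a metric \<Rightarrow> bool" where
  "metric_tree m \<longleftrightarrow> geodesic_space m \<and>
     (\<forall>x\<in>mspace m. \<forall>y\<in>mspace m. \<forall>z\<in>mspace m.
        x \<noteq> y \<and> y \<noteq> z \<and> x \<noteq> z \<longrightarrow>
        (\<forall>G1 G2. geodesic_segment m x y G1 \<and> geodesic_segment m y z G2 \<and> G1 \<inter> G2 = {y} \<longrightarrow>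
           geodesic_segment m x z (G1 \<union> G2)))"

section \<open>The Gromov--Hausdorff space\<close>

text \<open>
  Only meaningful for non-empty bounded subsets of \<open>mspace m\<close>; otherwise the real-valued
  suprema and infima are unspecified.
\<close>

definition hausdorff_dist :: "'a metric \<Rightarrow> 'a set \<Rightarrow> 'a set \<Rightarrow> real" where
  "hausdorff_dist m A B =
     max (SUP a\<in>A. INF b\<in>B. mdist m a b) (SUP b\<in>B. INF a\<in>A. mdist m a b)"

text \<open>
  HOL cannot quantify over metric spaces on all types at once, so all spaces are taken to have
  their carrier inside one fixed type. The type \<open>nat \<Rightarrow> real\<close> only serves as a set of cardinality
  continuum: every compact metric space, of whatever type, is isometric to a metric on a subset of
  it (\<open>compact_metric_isometric_copy\<close>), and ambient spaces \<open>Z\<close> on other types contribute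
  no further values to the infimum (\<open>GH_dist_ambient_space\<close>). The metrics on
  its subsets are arbitrary and unrelated to the product topology of \<open>nat \<Rightarrow> real\<close>.
\<close>

type_synonym univ = "nat \<Rightarrow> real"

definition GH_dist :: "'a metric \<Rightarrow> 'b metric \<Rightarrow> real" where
  "GH_dist X Y =
     Inf {hausdorff_dist Z (i ` mspace X) (j ` mspace Y) | (Z :: univ metric) i j.
            isometric_embedding X Z i \<and> isometric_embedding Y Z j}"

definition isometry_class :: "'a metric \<Rightarrow> univ metric set" where
  "isometry_class m = {m'. isometric m m'}"

definition GH_space :: "univ metric set set" where
  "GH_space = {isometry_class m | m :: univ metric.
                 mspace m \<noteq> {} \<and> compact_space (mtopology_of m)}"

text \<open>The choice of representatives is immaterial by \<open>GH_dist_cong\<close>.\<close>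

definition GH_class_dist :: "univ metric set \<Rightarrow> univ metric set \<Rightarrow> real" where
  "GH_class_dist C D = GH_dist (SOME X. X \<in> C) (SOME Y. Y \<in> D)"

text \<open>
  The open sets of \<open>Metric_space.mtopology GH_space GH_class_dist\<close>, spelled out because the
  characterization of \<open>Metric_space.mtopology\<close> is only available under the metric axioms.
\<close>

definition GH_topology :: "univ metric set topology" where
  "GH_topology = topology (\<lambda>U. U \<subseteq> GH_space \<and>
     (\<forall>C\<in>U. \<exists>r>0. \<forall>D\<in>GH_space. GH_class_dist C D < r \<longrightarrow> D \<in> U))"

definition GH_trees :: "univ metric set set" where
  "GH_trees = {isometry_class m | m :: univ metric.
                 mspace m \<noteq> {} \<and> compact_space (mtopology_of m) \<and> metric_tree m}"

definition GH_tree_topology :: "univ metric set topology" where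
  "GH_tree_topology = subtopology GH_topology GH_trees"

section \<open>Covering dimension\<close>

text \<open>
  The Cech--Lebesgue convention: finite open covers and finite open refinements, where the
  order of a cover is bounded by \<open>n\<close> iff no point lies in more than \<open>n + 1\<close> members. The empty
  space has dimension \<open>- 1\<close>.
\<close>

definition covering_dim_le :: "'a topology \<Rightarrow> int \<Rightarrow> bool" where
  "covering_dim_le X n \<longleftrightarrow>
     (\<forall>\<U>. finite \<U> \<and> (\<forall>U\<in>\<U>. openin X U) \<and> \<Union>\<U> = topspace X \<longrightarrow>
        (\<exists>\<V>. finite \<V> \<and> (\<forall>V\<in>\<V>. openin X V) \<and> \<Union>\<V> = topspace X \<and>
             (\<forall>V\<in>\<V>. \<exists>U\<in>\<U>. V \<subseteq> U) \<and>
             (\<forall>x\<in>topspace X. int (card {V \<in> \<V>. x \<in> V}) \<le> n + 1)))"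

definition covering_dim :: "'a topology \<Rightarrow> ereal" where
  "covering_dim X = (INF n\<in>{n. - 1 \<le> n \<and> covering_dim_le X n}. ereal (of_int n))"

section \<open>Independence of the choices made above\<close>

lemma isometric_embedding_compose:
  assumes "isometric_embedding X Y f" "isometric_embedding Y Z g"
  shows "isometric_embedding X Z (g \<circ> f)"
  using assms by (auto simp: isometric_embedding_def Pi_iff)

lemma isometric_refl: "isometric m m"
  unfolding isometric_def isometric_embedding_def by (rule exI[of _ id]) auto

lemma isometric_sym:
  assumes "isometric X Y"
  shows "isometric Y X"
proof -
  obtain f where f: "isometric_embedding X Y f" "f ` mspace X = mspace Y"
    using assms by (auto simp: isometric_def)
  have inj: "inj_on f (mspace X)"
    using f(1) unfolding isometric_embedding_def inj_on_def
    by (metis mdist_zero)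
  let ?g = "inv_into (mspace X) f"
  have 1: "?g y \<in> mspace X" "f (?g y) = y" if "y \<in> mspace Y" for y
    using that f(2) by (metis inv_into_into, metis f_inv_into_f)
  have "isometric_embedding Y X ?g"
    using f(1) 1 unfolding isometric_embedding_def by (metis Pi_I)
  moreover have "?g ` mspace Y = mspace X"
    using inj f(2) by (metis inv_into_image_cancel order_refl)
  ultimately show ?thesis
    by (auto simp: isometric_def)
qed

lemma isometric_trans:
  assumes "isometric X Y" "isometric Y Z"
  shows "isometric X Z"
  using assms unfolding isometric_def
  by (metis image_comp isometric_embedding_compose)

lemma isometry_class_eq_iff:
  fixes X Y :: "univ metric"
  shows "isometry_class X = isometry_class Y \<longleftrightarrow> isometric X Y"
  unfolding isometry_class_def
  by (metis (no_types, lifting) Collect_cong isometric_refl isometric_sym isometric_trans mem_Collect_eq)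

lemma GH_dist_cong:
  assumes "isometric X X'" "isometric Y Y'"
  shows "GH_dist X Y = GH_dist X' Y'"
proof -
  have sub: "{hausdorff_dist Z (i ` mspace X) (j ` mspace Y) | (Z :: univ metric) i j.
            isometric_embedding X Z i \<and> isometric_embedding Y Z j}
    \<subseteq> {hausdorff_dist Z (i ` mspace X') (j ` mspace Y') | (Z :: univ metric) i j.
            isometric_embedding X' Z i \<and> isometric_embedding Y' Z j}"
    if iso: "isometric X' X" "isometric Y' Y"
    for X :: "'e metric" and X' :: "'f metric" and Y :: "'g metric" and Y' :: "'h metric"
  proof -
    obtain f g where f: "isometric_embedding X' X f" "f ` mspace X' = mspace X"
      and g: "isometric_embedding Y' Y g" "g ` mspace Y' = mspace Y"
      using iso by (auto simp: isometric_def)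
    have "\<exists>(Z' :: univ metric) i' j'. hausdorff_dist Z (i ` mspace X) (j ` mspace Y)
              = hausdorff_dist Z' (i' ` mspace X') (j' ` mspace Y')
            \<and> isometric_embedding X' Z' i' \<and> isometric_embedding Y' Z' j'"
      if ij: "isometric_embedding X Z i" "isometric_embedding Y Z j" for Z :: "univ metric" and i j
      using isometric_embedding_compose[OF f(1) ij(1)] isometric_embedding_compose[OF g(1) ij(2)]
      by (intro exI[of _ Z] exI[of _ "i \<circ> f"] exI[of _ "j \<circ> g"])
        (simp only: image_comp[symmetric] f(2) g(2))
    then show ?thesis by blast
  qed
  show ?thesis
    unfolding GH_dist_def
    using sub[OF isometric_sym[OF assms(1)] isometric_sym[OF assms(2)]] sub[OF assms]
    by (metis (no_types, lifting) subset_antisym)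
qed

lemma GH_class_dist_isometry_class:
  fixes X Y :: "univ metric"
  shows "GH_class_dist (isometry_class X) (isometry_class Y) = GH_dist X Y"
proof -
  have "isometric M (SOME M'. M' \<in> isometry_class M)" for M :: "univ metric"
    using someI[of "\<lambda>M'. M' \<in> isometry_class M" M] isometric_refl
    by (auto simp: isometry_class_def)
  then show ?thesis
    unfolding GH_class_dist_def by (metis GH_dist_cong)
qed

text \<open>Transport of a metric along an injection into another type.\<close>

lemma isometric_copy:
  assumes "inj_on e (mspace m)"
  obtains m' where "mspace m' = e ` mspace m" "isometric_embedding m m' e"
proof -
  let ?g = "inv_into (mspace m) e"
  interpret Metric_space "e ` mspace m" "\<lambda>u v. mdist m (?g u) (?g v)"
  proof
    show "(mdist m (?g u) (?g v) = 0) = (u = v)" if "u \<in> e ` mspace m" "v \<in> e ` mspace m" for u v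
      using that assms by auto
  qed (auto simp: mdist_commute assms intro: mdist_triangle)
  show thesis
    by (rule that[of "metric (e ` mspace m, \<lambda>u v. mdist m (?g u) (?g v)) "])
      (auto simp: isometric_embedding_def assms)
qed

lemma compact_metric_inj_univ:
  fixes m :: "'a metric"
  assumes "compact_space (mtopology_of m)"
  obtains e :: "'a \<Rightarrow> univ" where "inj_on e (mspace m)"
proof -
  interpret Metric_space "mspace m" "mdist m" by simp
  have "mtotally_bounded (mspace m)"
    using assms by (simp add: mtopology_of_def compact_space_eq_mcomplete_mtotally_bounded)
  then have "\<exists>K. finite K \<and> K \<subseteq> mspace m \<and> mspace m \<subseteq> (\<Union>x\<in>K. mball x (1 / real (Suc n)))" for n
    unfolding mtotally_bounded_def by simp
  then obtain K where K: "\<And>n. finite (K n)" "\<And>n. K n \<subseteq> mspace m"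
      "\<And>n. mspace m \<subseteq> (\<Union>x\<in>K n. mball x (1 / real (Suc n)))"
    by metis
  define C where "C = (\<Union>n. K n)"
  have C: "countable C" "C \<subseteq> mspace m"
    using K by (auto simp: C_def intro: countable_finite)
  have dense: "\<exists>c\<in>C. mdist m x c < r" if xr: "x \<in> mspace m" "r > 0" for x r
  proof -
    obtain n where n: "1 / real (Suc n) < r"
      using nat_approx_posE[OF xr(2)] by blast
    obtain c where "c \<in> K n" "mdist m c x < 1 / real (Suc n)"
      using K(3)[of n] xr(1) by auto
    then show ?thesis
      using n by (intro bexI[of _ c]) (auto simp: C_def commute)
  qed
  define e where "e = (\<lambda>x n. mdist m x (from_nat_into C n))"
  have "x = y" if xy: "x \<in> mspace m" "y \<in> mspace m" "e x = e y" for x y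
  proof (rule ccontr)
    assume "x \<noteq> y"
    then have pos: "mdist m x y / 2 > 0" using xy by simp
    obtain c where c: "c \<in> C" "mdist m x c < mdist m x y / 2"
      using dense[OF xy(1) pos] by blast
    then have "mdist m x c = mdist m y c"
      using xy(3) C(1) unfolding e_def by (metis from_nat_into_surj)
    then have "mdist m x y \<le> mdist m x c + mdist m x c"
      using triangle[of x c y] commute[of c y] xy c C by auto
    then show False using c by simp
  qed
  then have "inj_on e (mspace m)" by (auto simp: inj_on_def)
  then show thesis by (rule that)
qed

lemma compact_metric_isometric_copy:
  fixes m :: "'a metric"
  assumes "compact_space (mtopology_of m)"
  shows "\<exists>m' :: univ metric. isometric m m'"
  by (metis assms compact_metric_inj_univ isometric_copy isometric_def)

lemma isometric_embedding_inj_on: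
  assumes "isometric_embedding X Y f"
  shows "inj_on f (mspace X)"
  using assms unfolding isometric_embedding_def inj_on_def by (metis mdist_zero)

lemma GH_dist_ambient_space:
  fixes X :: "'a metric" and Y :: "'b metric" and Z :: "'c metric"
  assumes cX: "compact_space (mtopology_of X)" and cY: "compact_space (mtopology_of Y)"
    and i: "isometric_embedding X Z i" and j: "isometric_embedding Y Z j"
  shows "\<exists>(Z' :: univ metric) i' j'.
           isometric_embedding X Z' i' \<and> isometric_embedding Y Z' j' \<and>
           hausdorff_dist Z' (i' ` mspace X) (j' ` mspace Y) =
           hausdorff_dist Z (i ` mspace X) (j ` mspace Y)"
proof -
  let ?A = "i ` mspace X" and ?B = "j ` mspace Y"
  obtain eX :: "'a \<Rightarrow> univ" where eX: "inj_on eX (mspace X)"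
    using compact_metric_inj_univ[OF cX] .
  obtain eY :: "'b \<Rightarrow> univ" where eY: "inj_on eY (mspace Y)"
    using compact_metric_inj_univ[OF cY] .
  define e :: "'c \<Rightarrow> univ" where
    "e = (\<lambda>z. if z \<in> ?A then case_nat 0 (eX (inv_into (mspace X) i z))
              else case_nat 1 (eY (inv_into (mspace Y) j z)))"
  have case_nat_eq: "case_nat a f = case_nat b g \<longleftrightarrow> a = b \<and> f = g" for a b :: real and f g
    by (auto simp: fun_eq_iff split: nat.split)
  have sub: "?A \<union> ?B \<subseteq> mspace Z"
    using i j by (auto simp: isometric_embedding_def)
  then have sp: "mspace (submetric Z (?A \<union> ?B)) = ?A \<union> ?B" by auto
  have inj: "inj_on e (?A \<union> ?B)"
  proof (rule inj_onI)
    fix u v assume uv: "u \<in> ?A \<union> ?B" "v \<in> ?A \<union> ?B" "e u = e v"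
    show "u = v"
    proof (cases "u \<in> ?A")
      case True
      then have "v \<in> ?A" "eX (inv_into (mspace X) i u) = eX (inv_into (mspace X) i v)"
        using uv(3) by (auto simp: e_def case_nat_eq split: if_splits)
      then show ?thesis
        using True eX by (metis inj_onD inv_into_into inv_into_injective)
    next
      case False
      then have "v \<notin> ?A" "eY (inv_into (mspace Y) j u) = eY (inv_into (mspace Y) j v)"
        using uv(3) by (auto simp: e_def case_nat_eq split: if_splits)
      moreover have "u \<in> ?B" "v \<in> ?B" using False calculation uv by auto
      ultimately show ?thesis
        using eY by (metis inj_onD inv_into_into inv_into_injective)
    qed
  qed
  then obtain Z' :: "univ metric" where
    Z': "isometric_embedding (submetric Z (?A \<union> ?B)) Z' e"
    using isometric_copy[of e "submetric Z (?A \<union> ?B)"] sp by metis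
  have d: "mdist Z' (e u) (e v) = mdist Z u v" if "u \<in> ?A \<union> ?B" "v \<in> ?A \<union> ?B" for u v
    using Z' that sp unfolding isometric_embedding_def by (metis mdist_submetric)
  have "isometric_embedding X (submetric Z (?A \<union> ?B)) i"
    "isometric_embedding Y (submetric Z (?A \<union> ?B)) j"
    using i j by (auto simp: isometric_embedding_def)
  then have emb: "isometric_embedding X Z' (e \<circ> i)" "isometric_embedding Y Z' (e \<circ> j)"
    using Z' isometric_embedding_compose by blast+
  have "hausdorff_dist Z' ((e \<circ> i) ` mspace X) ((e \<circ> j) ` mspace Y) = hausdorff_dist Z ?A ?B"
    unfolding hausdorff_dist_def image_comp[symmetric] image_image[of _ e]
    by (intro arg_cong2[where f = max] SUP_cong INF_cong) (simp_all add: d)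
  with emb show ?thesis by blast
qed

lemma openin_GH_topology:
  "openin GH_topology U \<longleftrightarrow>
     U \<subseteq> GH_space \<and>
     (\<forall>C\<in>U. \<exists>r>0. \<forall>D\<in>GH_space. GH_class_dist C D < r \<longrightarrow> D \<in> U)"
proof -
  let ?N = "\<lambda>U C r. \<forall>D\<in>GH_space. GH_class_dist C D < r \<longrightarrow> D \<in> U"
  let ?O = "\<lambda>U. U \<subseteq> GH_space \<and> (\<forall>C\<in>U. \<exists>r>0. ?N U C r)"
  have "istopology ?O"
    unfolding istopology_def
  proof (intro conjI allI impI ballI)
    fix S T assume S: "?O S" and T: "?O T"
    show "S \<inter> T \<subseteq> GH_space" using S by blast
    fix C assume "C \<in> S \<inter> T"
    then have "\<exists>r>0. ?N S C r" "\<exists>s>0. ?N T C s"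
      using S T by simp_all
    then obtain r s where "r > 0" "?N S C r" "s > 0" "?N T C s"
      by auto
    then show "\<exists>r>0. ?N (S \<inter> T) C r"
      by (intro exI[of _ "min r s"]) auto
  next
    fix \<K> assume \<K>: "\<forall>K\<in>\<K>. ?O K"
    show "\<Union>\<K> \<subseteq> GH_space" using \<K> by blast
    fix C assume "C \<in> \<Union>\<K>"
    then obtain K where "K \<in> \<K>" "C \<in> K" by blast
    with \<K> have "\<exists>r>0. ?N K C r" by simp
    then obtain r where "r > 0" "?N K C r" by auto
    with \<open>K \<in> \<K>\<close> show "\<exists>r>0. ?N (\<Union>\<K>) C r" by blast
  qed
  then show ?thesis
    by (simp add: GH_topology_def topology_inverse')
qed

end

theory Submission
  imports Defs
begin

text \<open>
  Metric trees are the geodesic spaces satisfying the four-point condition, and this makes it easy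
  to produce new trees.  Path-connectedness: closed balls about a point \<open>p\<close> of a tree are trees, and
  letting the radius shrink to \<open>0\<close> gives a path to the one-point space.

  Dimension: to a compact tree \<open>m\<close> attach at one point \<open>N\<close> groups of \<open>K\<close> short segments each, all
  segments of a group having the same length.  If \<open>K\<close> exceeds the packing number of \<open>m\<close> at the scale
  of the segments, then the \<open>N\<close> lengths can be recovered from packing radii, which are Lipschitz
  functions of the space. So every non-empty open set has the cube of dimension \<open>N\<close> as a
  retract.  If it had dimension at most \<open>n\<close>, a cover separating opposite faces of the cube
  would have a partition of unity \<open>\<phi>\<close> with at most \<open>n + 1\<close> members nonzero at each point. Sums of
  members of \<open>\<phi>\<close> then give a map \<open>g\<close> that is \<open>0\<close> and \<open>1\<close> on opposite faces, so that by the
  Poincare--Miranda theorem \<open>g\<close> takes a value with \<open>N\<close> distinct coordinates in \<open>{0<..<1}\<close>; but the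
  coordinates of \<open>g x\<close> are subsums of \<open>n + 1\<close> numbers, a contradiction for \<open>N > 2 ^ (n + 1)\<close>.
\<close>

section \<open>Geodesic segments and the four-point condition\<close>

lemma mdist_self [simp]: "x \<in> mspace m \<Longrightarrow> mdist m x x = 0"
  by simp

lemma mdist_le_zero_iff: "x \<in> mspace m \<Longrightarrow> y \<in> mspace m \<Longrightarrow> mdist m x y \<le> 0 \<longleftrightarrow> x = y"
  using mdist_nonneg[of m x y] mdist_zero[of x m y] by linarith

text \<open>Geodesics are normalized to start at time 0, so that the parameter is the distance from
  the initial point. For \<open>D < 0\<close> the condition is vacuous, hence
  \<open>0 \<le> D\<close> in \<open>geodesic_segmentI\<close>.\<close>

definition unit_speed :: "'a metric \<Rightarrow> real \<Rightarrow> (real \<Rightarrow> 'a) \<Rightarrow> bool" where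
  "unit_speed m D f \<longleftrightarrow>
     (\<forall>s\<in>{0..D}. f s \<in> mspace m) \<and> (\<forall>s\<in>{0..D}. \<forall>t\<in>{0..D}. mdist m (f s) (f t) = \<bar>s - t\<bar>)"

lemma unit_speed_in: "unit_speed m D f \<Longrightarrow> 0 \<le> s \<Longrightarrow> s \<le> D \<Longrightarrow> f s \<in> mspace m"
  by (simp add: unit_speed_def)

lemma unit_speed_dist:
  "unit_speed m D f \<Longrightarrow> 0 \<le> s \<Longrightarrow> s \<le> D \<Longrightarrow> 0 \<le> t \<Longrightarrow> t \<le> D \<Longrightarrow> mdist m (f s) (f t) = \<bar>s - t\<bar>"
  by (simp add: unit_speed_def)

lemma geodesic_segmentI:
  assumes "unit_speed m D f" "0 \<le> D" "f 0 = x" "f D = y" "S = f ` {0..D}"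
  shows "geodesic_segment m x y S"
  unfolding geodesic_segment_def isometric_embedding_def
  using assms unfolding unit_speed_def
  by (intro exI[of _ 0] exI[of _ D] conjI exI[of _ f]) (auto simp: dist_real_def)

text \<open>An isometric embedding of \<open>{a..b}\<close> forces \<open>b - a\<close> to be the
  distance of the endpoints; translating by \<open>a\<close> moves the interval to the
  origin.\<close>

lemma geodesic_segmentE:
  assumes "geodesic_segment m x y S"
  obtains f where "unit_speed m (mdist m x y) f" "f 0 = x" "f (mdist m x y) = y"
    "S = f ` {0..mdist m x y}" "x \<in> mspace m" "y \<in> mspace m"
proof -
  obtain a b f where ab: "a \<le> b" and f: "\<And>s. s \<in> {a..b} \<Longrightarrow> f s \<in> mspace m"
    "\<And>s t. s \<in> {a..b} \<Longrightarrow> t \<in> {a..b} \<Longrightarrow> mdist m (f s) (f t) = \<bar>s - t\<bar>"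
    and ends: "f a = x" "f b = y" "S = f ` {a..b}"
  proof -
    obtain a b :: real and f where "a \<le> b"
      "isometric_embedding (submetric euclidean_metric {a..b}) m f" "f a = x" "f b = y" "S = f ` {a..b}"
      using assms unfolding geodesic_segment_def by blast
    then show thesis
      by (intro that[of a b f]) (auto simp: isometric_embedding_def dist_real_def)
  qed
  have D: "mdist m x y = b - a"
    using f(2)[of a b] ab ends by auto
  have "f ` {a..b} = (\<lambda>t. f (a + t)) ` {0..b - a}"
    using image_add_atLeastAtMost[of a 0 "b - a"] by (simp add: image_image[symmetric])
  then show thesis
    using ab ends f[of a] f[of b] f D
    by (intro that[of "\<lambda>t. f (a + t)"]) (auto simp: unit_speed_def)
qed

lemma geodesic_segment_sub:
  assumes f: "unit_speed m D f" and st: "0 \<le> s" "s \<le> t" "t \<le> D"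
  shows "geodesic_segment m (f s) (f t) (f ` {s..t})"
proof (rule geodesic_segmentI)
  show "unit_speed m (t - s) (\<lambda>u. f (s + u))"
    using assms by (auto simp: unit_speed_def)
  show "f ` {s..t} = (\<lambda>u. f (s + u)) ` {0..t - s}"
    using image_add_atLeastAtMost[of s 0 "t - s"] by (simp add: image_image[symmetric])
qed (use st in auto)

lemma geodesic_segment_sub_rev:
  assumes f: "unit_speed m D f" and st: "0 \<le> s" "s \<le> t" "t \<le> D"
  shows "geodesic_segment m (f t) (f s) (f ` {s..t})"
proof (rule geodesic_segmentI)
  show "unit_speed m (t - s) (\<lambda>u. f (t - u))"
    using assms by (auto simp: unit_speed_def)
  show "f ` {s..t} = (\<lambda>u. f (t - u)) ` {0..t - s}"
    using image_diff_atLeastAtMost[of t 0 "t - s"] by (simp add: image_image[symmetric])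
qed (use st in auto)

lemma geodesic_segment_sym:
  assumes "geodesic_segment m x y S"
  shows "geodesic_segment m y x S"
  using assms
proof (rule geodesic_segmentE)
  fix f assume "unit_speed m (mdist m x y) f" "f 0 = x" "f (mdist m x y) = y"
    "S = f ` {0..mdist m x y}"
  then show ?thesis
    using geodesic_segment_sub_rev[of m "mdist m x y" f 0 "mdist m x y"] by simp
qed

lemma geodesic_segment_ends:
  assumes "geodesic_segment m x y S"
  shows "x \<in> S" "y \<in> S" "x \<in> mspace m" "y \<in> mspace m" "S \<subseteq> mspace m"
proof -
  obtain f where "unit_speed m (mdist m x y) f" "f 0 = x" "f (mdist m x y) = y"
    "S = f ` {0..mdist m x y}" "x \<in> mspace m" "y \<in> mspace m"
    using assms by (rule geodesic_segmentE)
  moreover have "f 0 \<in> f ` {0..mdist m x y}" "f (mdist m x y) \<in> f ` {0..mdist m x y}"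
    by (intro imageI; simp)+
  ultimately show "x \<in> S" "y \<in> S" "x \<in> mspace m" "y \<in> mspace m" "S \<subseteq> mspace m"
    by (auto simp: unit_speed_in)
qed

lemma geodesic_segment_between:
  assumes "geodesic_segment m x y S" "w \<in> S"
  shows "mdist m x w + mdist m w y = mdist m x y"
  using assms(1)
proof (rule geodesic_segmentE)
  fix f assume f: "unit_speed m (mdist m x y) f" "f 0 = x" "f (mdist m x y) = y"
    "S = f ` {0..mdist m x y}"
  then obtain t where t: "w = f t" "0 \<le> t" "t \<le> mdist m x y"
    using assms(2) by auto
  then show ?thesis
    using unit_speed_dist[OF f(1), of 0 t] unit_speed_dist[OF f(1), of t "mdist m x y"] f(2,3) by simp
qed

lemma geodesic_segment_dist:
  assumes "geodesic_segment m x y S" "v \<in> S" "w \<in> S"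
  shows "mdist m v w = \<bar>mdist m x v - mdist m x w\<bar>"
  using assms(1)
proof (rule geodesic_segmentE)
  fix f assume f: "unit_speed m (mdist m x y) f" "f 0 = x" "f (mdist m x y) = y"
    "S = f ` {0..mdist m x y}"
  then obtain s t where t: "w = f t" "0 \<le> t" "t \<le> mdist m x y" "v = f s" "0 \<le> s" "s \<le> mdist m x y"
    using assms(2,3) by auto
  then show ?thesis
    using unit_speed_dist[OF f(1), of 0 t] unit_speed_dist[OF f(1), of 0 s]
      unit_speed_dist[OF f(1), of s t] f(2) by simp
qed

lemma geodesic_segment_point:
  assumes "geodesic_segment m x y S" "0 \<le> t" "t \<le> mdist m x y"
  obtains w where "w \<in> S" "mdist m x w = t" "mdist m w y = mdist m x y - t"
  using assms(1)
proof (rule geodesic_segmentE)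
  fix f assume f: "unit_speed m (mdist m x y) f" "f 0 = x" "f (mdist m x y) = y"
    "S = f ` {0..mdist m x y}"
  then show ?thesis
    using unit_speed_dist[OF f(1), of 0 t] unit_speed_dist[OF f(1), of t "mdist m x y"] assms(2,3)
    by (intro that[of "f t"]) auto
qed

text \<open>Equality in the triangle inequality at the junction forces distances to add up for every
  pair of points on the two sides.\<close>

lemma geodesic_segment_concat:
  assumes 1: "geodesic_segment m x y S" and 2: "geodesic_segment m y z T"
    and add: "mdist m x y + mdist m y z = mdist m x z"
  shows "geodesic_segment m x z (S \<union> T)"
proof -
  let ?a = "mdist m x y" and ?b = "mdist m y z"
  obtain f where f: "unit_speed m ?a f" "f 0 = x" "f ?a = y" "S = f ` {0..?a}"
    using 1 by (rule geodesic_segmentE)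
  obtain g where g: "unit_speed m ?b g" "g 0 = y" "g ?b = z" "T = g ` {0..?b}"
    using 2 by (rule geodesic_segmentE)
  define h where "h t = (if t \<le> ?a then f t else g (t - ?a))" for t
  have M: "x \<in> mspace m" "y \<in> mspace m" "z \<in> mspace m"
    using 1 2 geodesic_segment_ends by metis+
  \<comment> \<open>The upper bound goes through \<open>y\<close>. The lower bound holds because the
    path \<open>x\<close>, \<open>f s\<close>, \<open>g t\<close>, \<open>z\<close> cannot be
    shorter than the distance from \<open>x\<close> to \<open>z\<close>.\<close>
  have cross: "mdist m (f s) (g t) = ?a - s + t" if "0 \<le> s" "s \<le> ?a" "0 \<le> t" "t \<le> ?b" for s t
  proof -
    have in_M: "f s \<in> mspace m" "g t \<in> mspace m"
      using that f(1) g(1) by (auto simp: unit_speed_in)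
    have fs: "mdist m x (f s) = s" "mdist m (f s) y = ?a - s"
      using unit_speed_dist[OF f(1), of 0 s] unit_speed_dist[OF f(1), of s ?a] that f(2,3) by auto
    have gt: "mdist m y (g t) = t" "mdist m (g t) z = ?b - t"
      using unit_speed_dist[OF g(1), of 0 t] unit_speed_dist[OF g(1), of t ?b] that g(2,3) by auto
    show ?thesis
      using mdist_triangle[of "f s" m y "g t"] mdist_triangle[of x m "f s" z]
        mdist_triangle[of "f s" m "g t" z] in_M M fs gt add by simp
  qed
  have "unit_speed m (?a + ?b) h"
    \<comment> \<open>Only pairs on different pieces need \<open>cross\<close>; all others are
      distances along \<open>f\<close> or along \<open>g\<close>.\<close>
    unfolding unit_speed_def h_def
    using unit_speed_in[OF f(1)] unit_speed_in[OF g(1)] unit_speed_dist[OF f(1)]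
      unit_speed_dist[OF g(1)] cross
    by (auto simp: mdist_commute[of m "g _" "f _"])
  moreover have "h (?a + ?b) = z"
  \<comment> \<open>For \<open>?b = 0\<close> the endpoint falls into the first branch of
    \<open>h\<close>, and then \<open>y = z\<close>.\<close>
  proof (cases "?b = 0")
    case True
    then show ?thesis using f(3) g(2,3) by (simp add: h_def)
  next
    case False
    then have "0 < ?b" using mdist_nonneg[of m y z] by linarith
    then show ?thesis using g(3) by (simp add: h_def)
  qed
  moreover have "h ` {0..?a + ?b} = S \<union> T"
  proof -
    have "h ` {0..?a} = S"
      unfolding f(4) h_def by (intro image_cong) auto
    moreover have "h ` {?a..?a + ?b} = T"
    proof -
      have "(+) ?a ` {0..?b} = {?a..?a + ?b}"
        using image_add_atLeastAtMost[of ?a 0 ?b] by (simp add: add.commute)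
      then have "h ` {?a..?a + ?b} = (h \<circ> (+) ?a) ` {0..?b}"
        by (metis image_comp)
      also have "\<dots> = T"
        unfolding g(4) h_def using f(3) g(2) by (intro image_cong) auto
      finally show ?thesis .
    qed
    moreover have "{0..?a + ?b} = {0..?a} \<union> {?a..?a + ?b}"
      by (simp add: ivl_disj_un_two_touch)
    ultimately show ?thesis by (simp add: image_Un)
  qed
  ultimately show ?thesis
    using f(2) by (intro geodesic_segmentI[of m "?a + ?b" h]) (auto simp: h_def)
qed

text \<open>Gromov's 0-hyperbolicity: of the three sums over the pairings of four points, the two
  largest agree.\<close>

definition four_point :: "'a metric \<Rightarrow> bool" where
  "four_point m \<longleftrightarrow>
     (\<forall>x\<in>mspace m. \<forall>y\<in>mspace m. \<forall>z\<in>mspace m. \<forall>w\<in>mspace m.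
        mdist m x y + mdist m z w \<le> max (mdist m x z + mdist m y w) (mdist m x w + mdist m y z))"

lemma four_pointD:
  assumes "four_point m" "x \<in> mspace m" "y \<in> mspace m" "z \<in> mspace m" "w \<in> mspace m"
  shows "mdist m x y + mdist m z w \<le> max (mdist m x z + mdist m y w) (mdist m x w + mdist m y z)"
  using assms by (simp add: four_point_def)

section \<open>Projections onto segments and the four-point characterization of trees\<close>

lemma metric_tree_segment:
  assumes "metric_tree m" "x \<in> mspace m" "y \<in> mspace m"
  obtains S where "geodesic_segment m x y S"
  using assms unfolding metric_tree_def geodesic_space_def by (elim conjE ballE exE) auto

lemma metric_tree_Un:
  assumes "metric_tree m" "x \<noteq> y \<and> y \<noteq> z \<and> x \<noteq> z" "geodesic_segment m x y G1" "geodesic_segment m y z G2"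
    "G1 \<inter> G2 = {y}"
  shows "geodesic_segment m x z (G1 \<union> G2)"
proof -
  have "x \<in> mspace m" "y \<in> mspace m" "z \<in> mspace m"
    using assms(3,4) by (simp_all add: geodesic_segment_ends)
  with assms show ?thesis
    by (simp add: metric_tree_def)
qed

text \<open>A segment from \<open>p\<close> to a nearest point \<open>q\<close> of \<open>S\<close>
  meets \<open>S\<close> only in \<open>q\<close>. The tree axiom therefore glues it to the part of
  \<open>S\<close> between \<open>q\<close> and \<open>w\<close>, so that \<open>q\<close> lies on a
  segment from \<open>p\<close> to \<open>w\<close>.\<close>

lemma metric_tree_nearest_point:
  assumes tree: "metric_tree m" and S: "geodesic_segment m x y S" and p: "p \<in> mspace m"
  obtains q where "q \<in> S" "\<And>w. w \<in> S \<Longrightarrow> mdist m p w = mdist m p q + mdist m q w"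
proof -
  let ?D = "mdist m x y"
  obtain f where f: "unit_speed m ?D f" "f 0 = x" "f ?D = y" "S = f ` {0..?D}"
    using S by (rule geodesic_segmentE)
  have SM: "S \<subseteq> mspace m" using S by (rule geodesic_segment_ends(5))
  \<comment> \<open>The distance to \<open>p\<close> is 1-Lipschitz along \<open>S\<close>, so it
    attains its minimum.\<close>
  have "\<bar>mdist m p (f s) - mdist m p (f t)\<bar> \<le> 1 * dist s t"
    if "0 \<le> s" "s \<le> ?D" "0 \<le> t" "t \<le> ?D" for s t
    using mdist_triangle[of p m "f s" "f t"] mdist_triangle[of p m "f t" "f s"] p
      unit_speed_in[OF f(1)] unit_speed_dist[OF f(1)] that
    by (auto simp: dist_real_def abs_le_iff abs_minus_commute)
  then have "1-lipschitz_on {0..?D} (\<lambda>t. mdist m p (f t))"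
    by (intro lipschitz_onI) (auto simp: dist_real_def)
  then have "continuous_on {0..?D} (\<lambda>t. mdist m p (f t))"
    by (rule lipschitz_on_continuous_on)
  then obtain t0 where t0: "t0 \<in> {0..?D}" "\<And>t. t \<in> {0..?D} \<Longrightarrow> mdist m p (f t0) \<le> mdist m p (f t)"
    using continuous_attains_inf[of "{0..?D}" "\<lambda>t. mdist m p (f t)"] by auto
  define q where "q = f t0"
  have q: "q \<in> S" "q \<in> mspace m" "\<And>w. w \<in> S \<Longrightarrow> mdist m p q \<le> mdist m p w"
    using t0 f(4) SM by (auto simp: q_def)
  have "mdist m p w = mdist m p q + mdist m q w" if w: "w \<in> S" for w
  proof (cases "p = q \<or> w = q")
    case True
    then show ?thesis using p q by auto
  next
    case False
    have wM: "w \<in> mspace m" using w SM by blast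
    obtain t1 where t1: "t1 \<in> {0..?D}" "w = f t1" using w f(4) by auto
    obtain G2 where G2: "geodesic_segment m q w G2" "G2 \<subseteq> S"
    proof (cases "t0 \<le> t1")
      case True
      then show ?thesis
        using geodesic_segment_sub[OF f(1), of t0 t1] t0 t1 f(4) q_def by (intro that) auto
    next
      case False
      then show ?thesis
        using geodesic_segment_sub_rev[OF f(1), of t1 t0] t0 t1 f(4) q_def by (intro that) auto
    qed
    obtain G1 where G1: "geodesic_segment m p q G1"
      using metric_tree_segment[OF tree p q(2)] .
    \<comment> \<open>Such a \<open>v\<close> lies between \<open>p\<close> and \<open>q\<close>
      but, being in \<open>S\<close>, is no closer to \<open>p\<close> than \<open>q\<close>
      is.\<close>
    have "v = q" if "v \<in> G1" "v \<in> G2" for v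
    proof -
      have "mdist m p v + mdist m v q = mdist m p q" "mdist m p q \<le> mdist m p v"
        using geodesic_segment_between[OF G1] q(3) that G2(2) by auto
      then have "mdist m v q = 0" using mdist_nonneg[of m v q] by linarith
      then show ?thesis using that SM G2(2) q by auto
    qed
    then have "G1 \<inter> G2 = {q}"
      using geodesic_segment_ends(2)[OF G1] geodesic_segment_ends(1)[OF G2(1)] by blast
    \<comment> \<open>The tree axiom applies to three distinct points only. If \<open>p = w\<close>,
      then \<open>p\<close> would lie in \<open>S\<close> and be its own nearest point.\<close>
    moreover have "p \<noteq> w"
    proof
      assume "p = w"
      then have "mdist m p q = 0" using q(3)[OF w] wM mdist_nonneg[of m p q] mdist_zero[of w m w]
        by (metis order_antisym)
      then show False using False p q(2) by simp
    qed
    ultimately have "geodesic_segment m p w (G1 \<union> G2)"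
      using metric_tree_Un[OF tree _ G1 G2(1)] False by blast
    then show ?thesis
      using geodesic_segment_between[of m p w "G1 \<union> G2" q] geodesic_segment_ends(2)[OF G1] by simp
  qed
  with q show thesis by (intro that)
qed

text \<open>By projecting \<open>w\<close> to \<open>S\<close>, the distances from \<open>w\<close>
  to the two ends exceed the length of \<open>S\<close> by twice the distance from \<open>w\<close>
  to \<open>S\<close>.\<close>

lemma metric_tree_mem_segment:
  assumes tree: "metric_tree m" and S: "geodesic_segment m x y S" and w: "w \<in> mspace m"
    and add: "mdist m x w + mdist m w y = mdist m x y"
  shows "w \<in> S"
proof -
  obtain q where q: "q \<in> S" "\<And>v. v \<in> S \<Longrightarrow> mdist m w v = mdist m w q + mdist m q v"
    using metric_tree_nearest_point[OF tree S w] by blast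
  have "mdist m w x + mdist m w y = 2 * mdist m w q + mdist m x y"
    using q(2)[of x] q(2)[of y] geodesic_segment_ends[OF S] geodesic_segment_between[OF S q(1)]
    by (simp add: mdist_commute)
  then have "mdist m w q = 0" using add by (simp add: mdist_commute)
  then show ?thesis using q(1) w geodesic_segment_ends(5)[OF S] by auto
qed

text \<open>Project \<open>w\<close> to segments from \<open>x\<close> and from \<open>y\<close> to
  \<open>z\<close>. Both projections lie on one segment from \<open>w\<close> to \<open>z\<close>,
  so their distance is a difference of distances from \<open>w\<close>. Bounding the distance from
  \<open>x\<close> to \<open>y\<close> by the path through them gives one of the two sums, according
  to which projection is closer to \<open>w\<close>.\<close>

lemma metric_tree_four_point:
  assumes tree: "metric_tree m"
  shows "four_point m"
  unfolding four_point_def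
proof (intro ballI)
  fix x y z w assume M: "x \<in> mspace m" "y \<in> mspace m" "z \<in> mspace m" "w \<in> mspace m"
  obtain Gx Gy S where G: "geodesic_segment m x z Gx" "geodesic_segment m y z Gy"
    "geodesic_segment m w z S"
    using metric_tree_segment[OF tree] M by metis
  obtain q1 where q1: "q1 \<in> Gx" "\<And>v. v \<in> Gx \<Longrightarrow> mdist m w v = mdist m w q1 + mdist m q1 v"
    using metric_tree_nearest_point[OF tree G(1) M(4)] by blast
  obtain q2 where q2: "q2 \<in> Gy" "\<And>v. v \<in> Gy \<Longrightarrow> mdist m w v = mdist m w q2 + mdist m q2 v"
    using metric_tree_nearest_point[OF tree G(2) M(4)] by blast
  have qM: "q1 \<in> mspace m" "q2 \<in> mspace m"
    using geodesic_segment_ends(5)[OF G(1)] geodesic_segment_ends(5)[OF G(2)] q1(1) q2(1) by auto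
  have e1: "mdist m w x = mdist m w q1 + mdist m q1 x" "mdist m w z = mdist m w q1 + mdist m q1 z"
    and e2: "mdist m w y = mdist m w q2 + mdist m q2 y" "mdist m w z = mdist m w q2 + mdist m q2 z"
    using q1(2)[OF geodesic_segment_ends(1)[OF G(1)]] q1(2)[OF geodesic_segment_ends(2)[OF G(1)]]
      q2(2)[OF geodesic_segment_ends(1)[OF G(2)]] q2(2)[OF geodesic_segment_ends(2)[OF G(2)]] by auto
  have "q1 \<in> S" "q2 \<in> S"
    using metric_tree_mem_segment[OF tree G(3)] qM e1(2) e2(2) by auto
  then have q12: "mdist m q1 q2 = \<bar>mdist m w q1 - mdist m w q2\<bar>"
    using geodesic_segment_dist[OF G(3)] by auto
  have b: "mdist m x q1 + mdist m q1 z = mdist m x z" "mdist m y q2 + mdist m q2 z = mdist m y z"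
    using geodesic_segment_between[OF G(1) q1(1)] geodesic_segment_between[OF G(2) q2(1)] by auto
  have t: "mdist m x y \<le> mdist m x q1 + mdist m q1 q2 + mdist m q2 y"
    using mdist_triangle[of x m q1 y] mdist_triangle[of q1 m q2 y] M qM by linarith
  show "mdist m x y + mdist m z w \<le> max (mdist m x z + mdist m y w) (mdist m x w + mdist m y z)"
    using e1 e2 q12 b t
    by (auto simp: max_def abs_if mdist_commute[of m x w] mdist_commute[of m y w] mdist_commute[of m z w]
        mdist_commute[of m q1 x] mdist_commute[of m q2 y])
qed

text \<open>The points of \<open>G1\<close> and \<open>G2\<close> at distance \<open>g\<close> from
  \<open>y\<close>, with \<open>g\<close> the Gromov product of \<open>x\<close> and
  \<open>z\<close> at \<open>y\<close>, coincide by the four-point condition. As the segments meet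
  in \<open>y\<close> only, \<open>g = 0\<close>, which is equality in the triangle
  inequality.\<close>

lemma metric_treeI:
  assumes geo: "geodesic_space m" and four: "four_point m"
  shows "metric_tree m"
  unfolding metric_tree_def
proof (intro conjI ballI impI allI geo)
  fix x y z G1 G2 assume M: "x \<in> mspace m" "y \<in> mspace m" "z \<in> mspace m"
    and "x \<noteq> y \<and> y \<noteq> z \<and> x \<noteq> z"
    and "geodesic_segment m x y G1 \<and> geodesic_segment m y z G2 \<and> G1 \<inter> G2 = {y}"
  then have G: "geodesic_segment m y x G1" "geodesic_segment m y z G2" "G1 \<inter> G2 = {y}"
    using geodesic_segment_sym by auto
  define g where "g = (mdist m y x + mdist m y z - mdist m x z) / 2"
  have tri: "mdist m x z \<le> mdist m y x + mdist m y z" "mdist m y x \<le> mdist m y z + mdist m x z"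
    "mdist m y z \<le> mdist m y x + mdist m x z"
    using mdist_triangle[of x m y z] mdist_triangle[of y m z x] mdist_triangle[of y m x z] M
    by (auto simp: mdist_commute)
  obtain u where u: "u \<in> G1" "mdist m y u = g" "mdist m u x = mdist m y x - g"
    using geodesic_segment_point[OF G(1), of g] tri by (auto simp: g_def)
  obtain v where v: "v \<in> G2" "mdist m y v = g" "mdist m v z = mdist m y z - g"
    using geodesic_segment_point[OF G(2), of g] tri by (auto simp: g_def)
  have uv: "u \<in> mspace m" "v \<in> mspace m"
    using geodesic_segment_ends(5)[OF G(1)] geodesic_segment_ends(5)[OF G(2)] u(1) v(1) by auto
  \<comment> \<open>In the first instance both sums on the right are equal, and it yields
    \<open>mdist m u z \<le> mdist m y z - g\<close>. Inserted into the second, this leaves no room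
    for a positive distance between \<open>u\<close> and \<open>v\<close>.\<close>
  have "mdist m u z + mdist m x y \<le> max (mdist m u x + mdist m z y) (mdist m u y + mdist m z x)"
    "mdist m u v + mdist m z y \<le> max (mdist m u z + mdist m v y) (mdist m u y + mdist m v z)"
    using four_pointD[OF four, of u z x y] four_pointD[OF four, of u v z y] uv M by auto
  then have "mdist m u v \<le> 0"
    using u(2,3) v(2,3) g_def
    unfolding mdist_commute[of m x y] mdist_commute[of m z y] mdist_commute[of m z x]
      mdist_commute[of m u y] mdist_commute[of m v y]
    by (simp add: max_def field_simps split: if_splits)
  then have "mdist m u v = 0" by (simp add: order_antisym)
  then have "u = v" using uv by simp
  then have "u = y" using u v G(3) by auto
  then have "g = 0" using u(2) M by simp
  then have "mdist m x y + mdist m y z = mdist m x z"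
    by (simp add: g_def mdist_commute)
  then show "geodesic_segment m x z (G1 \<union> G2)"
    by (rule geodesic_segment_concat[OF geodesic_segment_sym[OF G(1)] G(2)])
qed

section \<open>Trees under isometries and passage to convex subsets\<close>

lemma geodesic_segment_image:
  assumes e: "isometric_embedding m m' e" and S: "geodesic_segment m x y S"
  shows "geodesic_segment m' (e x) (e y) (e ` S)"
  using S
proof (rule geodesic_segmentE)
  fix f assume f: "unit_speed m (mdist m x y) f" "f 0 = x" "f (mdist m x y) = y"
    "S = f ` {0..mdist m x y}"
  show ?thesis
    using f e
    by (intro geodesic_segmentI[of m' "mdist m x y" "e \<circ> f"])
      (auto simp: unit_speed_def isometric_embedding_def image_comp)
qed

text \<open>With the four-point condition, segments need only be pushed forward; the arbitrary
  segments in the tree axiom for \<open>m'\<close> never have to be pulled back.\<close>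

lemma metric_tree_isometric:
  assumes iso: "isometric m m'" and tree: "metric_tree m"
  shows "metric_tree m'"
proof -
  obtain e where e: "isometric_embedding m m' e" "e ` mspace m = mspace m'"
    using iso by (auto simp: isometric_def)
  show ?thesis
  proof (rule metric_treeI)
    show "geodesic_space m'"
      unfolding geodesic_space_def e(2)[symmetric]
    proof (intro ballI)
      fix x' y' assume "x' \<in> e ` mspace m" "y' \<in> e ` mspace m"
      then obtain x y where xy: "x \<in> mspace m" "y \<in> mspace m" "x' = e x" "y' = e y"
        by auto
      obtain S where "geodesic_segment m x y S"
        using metric_tree_segment[OF tree xy(1,2)] .
      then show "\<exists>S. geodesic_segment m' x' y' S"
        using geodesic_segment_image[OF e(1)] xy(3,4) by blast
    qed
    show "four_point m'"
      using metric_tree_four_point[OF tree] e(1)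
      unfolding four_point_def e(2)[symmetric] by (simp add: isometric_embedding_def)
  qed
qed

text \<open>The four-point condition passes to every subset; convexity supplies the
  segments.\<close>

lemma metric_tree_submetric:
  assumes tree: "metric_tree m"
    and cvx: "\<And>x y S. x \<in> A \<Longrightarrow> y \<in> A \<Longrightarrow> geodesic_segment m x y S \<Longrightarrow> S \<subseteq> A"
  shows "metric_tree (submetric m A)"
proof (rule metric_treeI)
  show "four_point (submetric m A)"
    using metric_tree_four_point[OF tree] by (simp add: four_point_def)
  show "geodesic_space (submetric m A)"
    unfolding geodesic_space_def
  proof (intro ballI)
    fix x y assume xy: "x \<in> mspace (submetric m A)" "y \<in> mspace (submetric m A)"
    then obtain S where S: "geodesic_segment m x y S"
      using metric_tree_segment[OF tree, of x y] by auto
    then have "S \<subseteq> A" using cvx[of x y S] xy by simp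
    obtain f where f: "unit_speed m (mdist m x y) f" "f 0 = x" "f (mdist m x y) = y"
      "S = f ` {0..mdist m x y}"
      using S by (rule geodesic_segmentE)
    have "unit_speed (submetric m A) (mdist m x y) f"
      using f(1,4) \<open>S \<subseteq> A\<close> by (auto simp: unit_speed_def)
    then have "geodesic_segment (submetric m A) x y S"
      using f by (intro geodesic_segmentI) auto
    then show "\<exists>S. geodesic_segment (submetric m A) x y S" ..
  qed
qed

text \<open>Balls are convex, by the four-point condition for the pairs \<open>p\<close>,
  \<open>w\<close> and \<open>x\<close>, \<open>y\<close>: as \<open>w\<close> lies between
  \<open>x\<close> and \<open>y\<close>, each sum on the right is at most
  \<open>t + mdist m x y\<close>.\<close>

lemma metric_tree_ball_convex:
  assumes tree: "metric_tree m" and p: "p \<in> mspace m"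
    and S: "geodesic_segment m x y S" and xy: "mdist m p x \<le> t" "mdist m p y \<le> t" and w: "w \<in> S"
  shows "mdist m p w \<le> t"
proof -
  have M: "x \<in> mspace m" "y \<in> mspace m" "w \<in> mspace m"
    using geodesic_segment_ends[OF S] w by auto
  have "mdist m p w + mdist m x y \<le> max (mdist m p x + mdist m w y) (mdist m p y + mdist m w x)"
    using four_pointD[OF metric_tree_four_point[OF tree]] M p by blast
  moreover have "mdist m x w + mdist m w y = mdist m x y"
    using geodesic_segment_between[OF S w] .
  ultimately show ?thesis
    using xy by (smt (verit) mdist_commute mdist_nonneg)
qed

section \<open>Gromov--Hausdorff distance\<close>

lemma compact_space_mbounded:
  assumes "compact_space (mtopology_of m)"
  obtains B where "\<And>x y. x \<in> mspace m \<Longrightarrow> y \<in> mspace m \<Longrightarrow> mdist m x y \<le> B"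
proof -
  interpret Metric_space "mspace m" "mdist m" by simp
  have "mbounded (mspace m)"
    using assms compactin_imp_mbounded[of "mspace m"] by (simp add: compact_space_def mtopology_of_def)
  then show thesis
    using that unfolding mbounded_alt by blast
qed

lemma isometric_embedding_continuous_map:
  assumes "isometric_embedding m m' f"
  shows "continuous_map (mtopology_of m) (mtopology_of m') f"
proof -
  have "Lipschitz_continuous_map m m' f"
    using assms by (auto simp: Lipschitz_continuous_map_def isometric_embedding_def intro!: exI[of _ 1])
  then show ?thesis by (rule Lipschitz_continuous_imp_continuous_map)
qed

lemma compact_space_isometric:
  assumes "isometric m m'" "compact_space (mtopology_of m)"
  shows "compact_space (mtopology_of m')"
proof -
  obtain f where f: "isometric_embedding m m' f" "f ` mspace m = mspace m'"
    using assms by (auto simp: isometric_def)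
  then show ?thesis
    using image_compactin[OF _ isometric_embedding_continuous_map[OF f(1)], of "mspace m"] assms(2)
    by (simp add: compact_space_def)
qed

section \<open>Estimates for the Hausdorff and Gromov--Hausdorff distances\<close>

lemma hausdorff_dist_le:
  assumes "A \<noteq> {}" "B \<noteq> {}"
    and "\<And>a. a \<in> A \<Longrightarrow> \<exists>b\<in>B. mdist m a b \<le> e" "\<And>b. b \<in> B \<Longrightarrow> \<exists>a\<in>A. mdist m a b \<le> e"
  shows "hausdorff_dist m A B \<le> e"
proof -
  have bdd: "bdd_below ((\<lambda>x. mdist m (f x) (g x)) ` S)" for f g :: "'b \<Rightarrow> 'a" and S
    by (rule bdd_belowI2[of _ 0]) simp
  have "(SUP a\<in>A. INF b\<in>B. mdist m a b) \<le> e"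
  proof (intro cSUP_least assms(1))
    fix a assume "a \<in> A"
    then obtain b where "b \<in> B" "mdist m a b \<le> e" using assms(3) by blast
    then show "(INF b\<in>B. mdist m a b) \<le> e" by (rule cINF_lower2[OF bdd])
  qed
  moreover have "(SUP b\<in>B. INF a\<in>A. mdist m a b) \<le> e"
  proof (intro cSUP_least assms(2))
    fix b assume "b \<in> B"
    then obtain a where "a \<in> A" "mdist m a b \<le> e" using assms(4) by blast
    then show "(INF a\<in>A. mdist m a b) \<le> e" by (rule cINF_lower2[OF bdd])
  qed
  ultimately show ?thesis by (simp add: hausdorff_dist_def)
qed

lemma hausdorff_dist_swap: "hausdorff_dist m A B = hausdorff_dist m B A"
  by (simp add: hausdorff_dist_def max.commute mdist_commute)

text \<open>Real suprema of unbounded sets are unspecified, so a uniform bound \<open>K\<close> on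
  the mutual distances is carried along.\<close>

lemma hausdorff_dist_bdd_above:
  assumes "B \<noteq> {}" and bd: "\<And>a b. a \<in> A \<Longrightarrow> b \<in> B \<Longrightarrow> mdist m a b \<le> K"
  shows "bdd_above ((\<lambda>a. INF b\<in>B. mdist m a b) ` A)"
proof (rule bdd_aboveI2)
  fix a assume a: "a \<in> A"
  obtain b where b: "b \<in> B" using assms by auto
  have "(INF b\<in>B. mdist m a b) \<le> mdist m a b"
    using b by (intro cINF_lower bdd_belowI2[of _ 0]) auto
  also have "\<dots> \<le> K" using bd a b by blast
  finally show "(INF b\<in>B. mdist m a b) \<le> K" .
qed

lemma hausdorff_dist_lessD:
  assumes "B \<noteq> {}" and bd: "\<And>a b. a \<in> A \<Longrightarrow> b \<in> B \<Longrightarrow> mdist m a b \<le> K"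
    and less: "hausdorff_dist m A B < e" and a: "a \<in> A"
  shows "\<exists>b\<in>B. mdist m a b < e"
proof -
  have "(INF b\<in>B. mdist m a b) \<le> (SUP a\<in>A. INF b\<in>B. mdist m a b)"
    using a hausdorff_dist_bdd_above[OF assms(1) bd] by (rule cSUP_upper)
  also have "\<dots> < e" using less by (simp add: hausdorff_dist_def)
  finally show ?thesis
    using assms(1) cInf_lessD[of "mdist m a ` B" e] by auto
qed

lemma hausdorff_dist_nonneg:
  assumes "A \<noteq> {}" "B \<noteq> {}" and bd: "\<And>a b. a \<in> A \<Longrightarrow> b \<in> B \<Longrightarrow> mdist m a b \<le> K"
  shows "0 \<le> hausdorff_dist m A B"
proof -
  obtain a where a: "a \<in> A" using assms by auto
  have "0 \<le> (INF b\<in>B. mdist m a b)"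
    using assms by (intro cINF_greatest) auto
  also have "\<dots> \<le> (SUP a\<in>A. INF b\<in>B. mdist m a b)"
    using a hausdorff_dist_bdd_above[OF assms(2) bd] by (rule cSUP_upper)
  finally show ?thesis by (simp add: hausdorff_dist_def)
qed

text \<open>Supplies this bound in any ambient space: the diameters of \<open>X\<close> and
  \<open>Y\<close> plus the distance of two base points.\<close>

lemma isometric_embeddings_bounded:
  assumes cX: "compact_space (mtopology_of X)" and cY: "compact_space (mtopology_of Y)"
    and i: "isometric_embedding X Z i" and j: "isometric_embedding Y Z j"
  obtains K where "\<And>a b. a \<in> i ` mspace X \<Longrightarrow> b \<in> j ` mspace Y \<Longrightarrow> mdist Z a b \<le> K"
proof (cases "mspace X = {} \<or> mspace Y = {}")
  case True
  then show ?thesis by (intro that[of 0]) auto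
next
  case False
  then obtain x0 y0 where 0: "x0 \<in> mspace X" "y0 \<in> mspace Y" by auto
  obtain A where A: "\<And>x y. x \<in> mspace X \<Longrightarrow> y \<in> mspace X \<Longrightarrow> mdist X x y \<le> A"
    using compact_space_mbounded[OF cX] by blast
  obtain B where B: "\<And>x y. x \<in> mspace Y \<Longrightarrow> y \<in> mspace Y \<Longrightarrow> mdist Y x y \<le> B"
    using compact_space_mbounded[OF cY] by blast
  have "mdist Z (i x) (j y) \<le> A + mdist Z (i x0) (j y0) + B" if "x \<in> mspace X" "y \<in> mspace Y" for x y
  proof -
    have M: "i x \<in> mspace Z" "i x0 \<in> mspace Z" "j y \<in> mspace Z" "j y0 \<in> mspace Z"
      using i j 0 that by (auto simp: isometric_embedding_def)
    have "mdist Z (i x) (i x0) \<le> A" "mdist Z (j y0) (j y) \<le> B"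
      using i j 0 that A B by (auto simp: isometric_embedding_def)
    then show ?thesis
      using mdist_triangle[OF M(1,2,3)] mdist_triangle[OF M(2,4,3)] by linarith
  qed
  then show ?thesis by (intro that) auto
qed

text \<open>Without a common ambient space the infimum defining \<^const>\<open>GH_dist\<close> would be junk.\<close>

lemma common_ambient_space_exists:
  fixes X :: "'a metric" and Y :: "'b metric"
  assumes "compact_space (mtopology_of X)" "compact_space (mtopology_of Y)"
    and "mspace X \<noteq> {}" "mspace Y \<noteq> {}"
  shows "\<exists>(Z :: univ metric) i j. isometric_embedding X Z i \<and> isometric_embedding Y Z j"
proof -
  obtain x0 y0 where 0: "x0 \<in> mspace X" "y0 \<in> mspace Y" using assms by auto
  have "isometric_embedding X (prod_metric X Y) (\<lambda>x. (x, y0))"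
    "isometric_embedding Y (prod_metric X Y) (\<lambda>y. (x0, y))"
    using 0 by (auto simp: isometric_embedding_def prod_dist_def)
  then show ?thesis
    using GH_dist_ambient_space[OF assms(1,2)] by blast
qed

text \<open>Here \<open>Z\<close> may live on any type: by \<open>GH_dist_ambient_space\<close> it
  contributes a value to the infimum, which is bounded below by 0.\<close>

lemma GH_dist_le:
  fixes X :: "'a metric" and Y :: "'b metric" and Z :: "'c metric"
  assumes c: "compact_space (mtopology_of X)" "compact_space (mtopology_of Y)"
    and ne: "mspace X \<noteq> {}" "mspace Y \<noteq> {}"
    and ij: "isometric_embedding X Z i" "isometric_embedding Y Z j"
    and le: "\<And>x. x \<in> mspace X \<Longrightarrow> \<exists>y\<in>mspace Y. mdist Z (i x) (j y) \<le> e"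
      "\<And>y. y \<in> mspace Y \<Longrightarrow> \<exists>x\<in>mspace X. mdist Z (i x) (j y) \<le> e"
  shows "GH_dist X Y \<le> e"
proof -
  let ?H = "{hausdorff_dist Z (i ` mspace X) (j ` mspace Y) | (Z :: univ metric) i j.
            isometric_embedding X Z i \<and> isometric_embedding Y Z j}"
  have "hausdorff_dist Z (i ` mspace X) (j ` mspace Y) \<le> e"
    using le ne by (intro hausdorff_dist_le) auto
  moreover have "hausdorff_dist Z (i ` mspace X) (j ` mspace Y) \<in> ?H"
    using GH_dist_ambient_space[OF c ij] by (metis (mono_tags, lifting) mem_Collect_eq)
  moreover have "bdd_below ?H"
  proof (rule bdd_belowI[of _ 0])
    fix h assume "h \<in> ?H"
    then obtain Z :: "univ metric" and i j where h: "h = hausdorff_dist Z (i ` mspace X) (j ` mspace Y)"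
      "isometric_embedding X Z i" "isometric_embedding Y Z j" by blast
    obtain K where "\<And>a b. a \<in> i ` mspace X \<Longrightarrow> b \<in> j ` mspace Y \<Longrightarrow> mdist Z a b \<le> K"
      using isometric_embeddings_bounded[OF c h(2,3)] by blast
    then show "0 \<le> h"
      unfolding h(1) using ne by (intro hausdorff_dist_nonneg) auto
  qed
  ultimately show ?thesis
    unfolding GH_dist_def by (meson cInf_lower order_trans)
qed

lemma GH_dist_lessE:
  fixes X :: "'a metric" and Y :: "'b metric"
  assumes c: "compact_space (mtopology_of X)" "compact_space (mtopology_of Y)"
    and ne: "mspace X \<noteq> {}" "mspace Y \<noteq> {}" and less: "GH_dist X Y < e"
  obtains Z :: "univ metric" and i j where "isometric_embedding X Z i" "isometric_embedding Y Z j"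
    "\<And>x. x \<in> mspace X \<Longrightarrow> \<exists>y\<in>mspace Y. mdist Z (i x) (j y) < e"
    "\<And>y. y \<in> mspace Y \<Longrightarrow> \<exists>x\<in>mspace X. mdist Z (i x) (j y) < e"
proof -
  let ?H = "{hausdorff_dist Z (i ` mspace X) (j ` mspace Y) | (Z :: univ metric) i j.
            isometric_embedding X Z i \<and> isometric_embedding Y Z j}"
  have "?H \<noteq> {}"
    using common_ambient_space_exists[OF c ne] by blast
  then have "\<exists>h\<in>?H. h < e"
    using less unfolding GH_dist_def by (meson cInf_lessD)
  then obtain Z :: "univ metric" and i j where ij: "isometric_embedding X Z i" "isometric_embedding Y Z j"
    and h: "hausdorff_dist Z (i ` mspace X) (j ` mspace Y) < e" by blast
  obtain K where K: "\<And>a b. a \<in> i ` mspace X \<Longrightarrow> b \<in> j ` mspace Y \<Longrightarrow> mdist Z a b \<le> K"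
    using isometric_embeddings_bounded[OF c ij] by blast
  show thesis
  proof (rule that[OF ij])
    fix x assume "x \<in> mspace X"
    then show "\<exists>y\<in>mspace Y. mdist Z (i x) (j y) < e"
      using hausdorff_dist_lessD[OF _ K h, of "i x"] ne by auto
  next
    fix y assume "y \<in> mspace Y"
    moreover have "mdist Z a b \<le> K" if "a \<in> j ` mspace Y" "b \<in> i ` mspace X" for a b
      using K[OF that(2,1)] by (simp add: mdist_commute)
    ultimately show "\<exists>x\<in>mspace X. mdist Z (i x) (j y) < e"
      using hausdorff_dist_lessD[of "i ` mspace X" "j ` mspace Y" Z K e "j y"] h ne
      by (auto simp: hausdorff_dist_swap mdist_commute)
  qed
qed

text \<open>Isometry classes consist of metrics on \<open>univ\<close>, whereas the trees
  constructed below live on sum types.\<close>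

lemma isometry_class_copy:
  fixes m :: "'a metric"
  assumes "compact_space (mtopology_of m)"
  obtains m' :: "univ metric" where "isometric m m'" "isometry_class m = isometry_class m'"
proof -
  obtain m' :: "univ metric" where m': "isometric m m'"
    using compact_metric_isometric_copy[OF assms] by blast
  moreover have "isometry_class m = isometry_class m'"
    by (auto simp: isometry_class_def intro: isometric_trans[OF m'] isometric_trans[OF isometric_sym[OF m']])
  ultimately show thesis by (rule that)
qed

section \<open>The space of compact trees and continuous families in it\<close>

lemma isometric_nonempty: "isometric m m' \<Longrightarrow> mspace m \<noteq> {} \<Longrightarrow> mspace m' \<noteq> {}"
  by (auto simp: isometric_def)

lemma isometry_class_in_GH_trees:
  fixes m :: "'a metric"
  assumes "mspace m \<noteq> {}" "compact_space (mtopology_of m)" "metric_tree m"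
  shows "isometry_class m \<in> GH_trees"
proof -
  obtain m' :: "univ metric" where m': "isometric m m'" "isometry_class m = isometry_class m'"
    using isometry_class_copy[OF assms(2)] .
  have "mspace m' \<noteq> {} \<and> compact_space (mtopology_of m') \<and> metric_tree m'"
    using assms isometric_nonempty[OF m'(1)] compact_space_isometric[OF m'(1)]
      metric_tree_isometric[OF m'(1)] by simp
  then show ?thesis
    unfolding GH_trees_def m'(2) by blast
qed

lemma GH_trees_subset: "GH_trees \<subseteq> GH_space"
  by (auto simp: GH_trees_def GH_space_def)

lemma topspace_GH_tree_topology: "topspace GH_tree_topology = GH_trees"
proof -
  have "openin GH_topology GH_space"
    unfolding openin_GH_topology by (auto intro: exI[of _ 1])
  then have "GH_space \<subseteq> topspace GH_topology" by (rule openin_subset)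
  then show ?thesis
    using GH_trees_subset by (auto simp: GH_tree_topology_def)
qed

lemma GH_class_dist_isometry_class_compact:
  fixes X :: "'a metric" and Y :: "'b metric"
  assumes "compact_space (mtopology_of X)" "compact_space (mtopology_of Y)"
  shows "GH_class_dist (isometry_class X) (isometry_class Y) = GH_dist X Y"
proof -
  obtain X' :: "univ metric" where X': "isometric X X'" "isometry_class X = isometry_class X'"
    using isometry_class_copy[OF assms(1)] .
  obtain Y' :: "univ metric" where Y': "isometric Y Y'" "isometry_class Y = isometry_class Y'"
    using isometry_class_copy[OF assms(2)] .
  show ?thesis
    unfolding X'(2) Y'(2) GH_class_dist_isometry_class using GH_dist_cong[OF X'(1) Y'(1)] ..
qed

text \<open>An open set contains a ball about each of its points, so an epsilon-delta estimate at
  every parameter gives continuity.\<close>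

lemma GH_tree_topology_continuous_mapI:
  fixes Y :: "'b::metric_space \<Rightarrow> 'a metric"
  assumes compact: "\<And>a. a \<in> S \<Longrightarrow> compact_space (mtopology_of (Y a))"
    and ne: "\<And>a. a \<in> S \<Longrightarrow> mspace (Y a) \<noteq> {}" and tree: "\<And>a. a \<in> S \<Longrightarrow> metric_tree (Y a)"
    and cont: "\<And>a e. a \<in> S \<Longrightarrow> 0 < e \<Longrightarrow> \<exists>d>0. \<forall>b\<in>S. dist b a < d \<longrightarrow> GH_dist (Y a) (Y b) < e"
  shows "continuous_map (top_of_set S) GH_tree_topology (\<lambda>a. isometry_class (Y a))"
  unfolding GH_tree_topology_def continuous_map_in_subtopology
proof (intro conjI)
  have in_trees: "isometry_class (Y a) \<in> GH_trees" if "a \<in> S" for a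
    using that assms by (intro isometry_class_in_GH_trees) auto
  then show "(\<lambda>a. isometry_class (Y a)) \<in> topspace (top_of_set S) \<rightarrow> GH_trees" by auto
  show "continuous_map (top_of_set S) GH_topology (\<lambda>a. isometry_class (Y a))"
    unfolding continuous_map_def
  proof (intro conjI allI impI)
    show "(\<lambda>a. isometry_class (Y a)) \<in> topspace (top_of_set S) \<rightarrow> topspace GH_topology"
      using in_trees topspace_GH_tree_topology by (auto simp: GH_tree_topology_def)
    fix U assume U: "openin GH_topology U"
    have "\<exists>d>0. \<forall>b\<in>S. dist b a < d \<longrightarrow> isometry_class (Y b) \<in> U"
      if a: "a \<in> S" "isometry_class (Y a) \<in> U" for a
    proof -
      obtain r where r: "r > 0"
        "\<And>D. D \<in> GH_space \<Longrightarrow> GH_class_dist (isometry_class (Y a)) D < r \<Longrightarrow> D \<in> U"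
        using U a(2) unfolding openin_GH_topology by blast
      obtain d where d: "d > 0" "\<And>b. b \<in> S \<Longrightarrow> dist b a < d \<Longrightarrow> GH_dist (Y a) (Y b) < r"
        using cont[OF a(1) r(1)] by blast
      have "isometry_class (Y b) \<in> U" if "b \<in> S" "dist b a < d" for b
        using r(2)[of "isometry_class (Y b)"] d(2)[OF that] in_trees GH_trees_subset that(1) a(1)
          GH_class_dist_isometry_class_compact[OF compact compact, of a b] by auto
      then show ?thesis using d(1) by blast
    qed
    then show "openin (top_of_set S) {a \<in> topspace (top_of_set S). isometry_class (Y a) \<in> U}"
      unfolding openin_euclidean_subtopology_iff by (auto simp: dist_commute)
  qed
qed

section \<open>Path-connectedness\<close>

definition trimmed :: "'a metric \<Rightarrow> 'a \<Rightarrow> real \<Rightarrow> 'a metric" where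
  "trimmed m p t = submetric m {x. mdist m p x \<le> t}"

lemma mspace_trimmed: "mspace (trimmed m p t) = {x \<in> mspace m. mdist m p x \<le> t}"
  by (auto simp: trimmed_def)

lemma compact_space_trimmed:
  assumes "compact_space (mtopology_of m)" "p \<in> mspace m"
  shows "compact_space (mtopology_of (trimmed m p t))"
proof -
  interpret Metric_space "mspace m" "mdist m" by simp
  have "compactin mtopology (mcball p t)"
    using assms by (intro closedin_compact_space) (auto simp: mtopology_of_def)
  moreover have "trimmed m p t = submetric m (mcball p t)"
  proof -
    have "mspace m \<inter> {x. mdist m p x \<le> t} = mcball p t" using assms(2) by auto
    then show ?thesis
      unfolding trimmed_def by (subst submetric_restrict) simp
  qed
  moreover have "mtopology_of m = mtopology" by (simp add: mtopology_of_def)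
  ultimately show ?thesis
    by (simp add: mtopology_of_submetric compactin_subspace)
qed

lemma metric_tree_trimmed:
  assumes "metric_tree m" "p \<in> mspace m"
  shows "metric_tree (trimmed m p t)"
  unfolding trimmed_def
  by (rule metric_tree_submetric[OF assms(1)]) (use metric_tree_ball_convex[OF assms] in auto)

text \<open>A point too far from \<open>p\<close> is moved along a segment towards \<open>p\<close>
  until its distance from \<open>p\<close> is \<open>t\<close>.\<close>

lemma metric_tree_retract_point:
  assumes tree: "metric_tree m" and M: "p \<in> mspace m" "x \<in> mspace m" and st: "0 \<le> t" "mdist m p x \<le> s"
  shows "\<exists>y\<in>mspace m. mdist m p y \<le> t \<and> mdist m x y \<le> \<bar>s - t\<bar>"
proof (cases "mdist m p x \<le> t")
  case True
  then show ?thesis using M by (intro bexI[of _ x]) auto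
next
  case False
  obtain S where S: "geodesic_segment m p x S"
    using metric_tree_segment[OF tree M] .
  obtain y where "y \<in> S" "mdist m p y = t" "mdist m y x = mdist m p x - t"
    using geodesic_segment_point[OF S, of t] st False by auto
  then show ?thesis
    using geodesic_segment_ends(5)[OF S] st False by (intro bexI[of _ y]) (auto simp: mdist_commute[of m x y])
qed

lemma GH_dist_trimmed_le:
  assumes tree: "metric_tree m" and c: "compact_space (mtopology_of m)" and p: "p \<in> mspace m"
    and st: "0 \<le> s" "0 \<le> t"
  shows "GH_dist (trimmed m p s) (trimmed m p t) \<le> \<bar>s - t\<bar>"
proof (rule GH_dist_le[where Z = m and i = "\<lambda>x. x" and j = "\<lambda>x. x"])
  show "mspace (trimmed m p s) \<noteq> {}" "mspace (trimmed m p t) \<noteq> {}"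
    using p st by (auto simp: mspace_trimmed intro!: exI[of _ p])
  show "isometric_embedding (trimmed m p s) m (\<lambda>x. x)" "isometric_embedding (trimmed m p t) m (\<lambda>x. x)"
    by (auto simp: isometric_embedding_def trimmed_def)
  show "\<exists>y\<in>mspace (trimmed m p t). mdist m x y \<le> \<bar>s - t\<bar>" if "x \<in> mspace (trimmed m p s)" for x
    using metric_tree_retract_point[OF tree p, of x t s] that st by (auto simp: mspace_trimmed)
  show "\<exists>x\<in>mspace (trimmed m p s). mdist m x y \<le> \<bar>s - t\<bar>" if "y \<in> mspace (trimmed m p t)" for y
    using metric_tree_retract_point[OF tree p, of y s t] that st
    by (auto simp: mspace_trimmed mdist_commute[of m _ y] abs_minus_commute)
qed (rule compact_space_trimmed[OF c p])+

text \<open>The path consists of the balls of radius \<open>t * B\<close> about \<open>p\<close>,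
  where \<open>B\<close> bounds the diameter, so that it ends in \<open>m\<close> itself.\<close>

lemma path_component_of_point:
  assumes tree: "metric_tree m" and c: "compact_space (mtopology_of m)" and p: "p \<in> mspace m"
  shows "path_component_of GH_tree_topology (isometry_class (trimmed m p 0)) (isometry_class m)"
proof -
  obtain B where B: "\<And>x y. x \<in> mspace m \<Longrightarrow> y \<in> mspace m \<Longrightarrow> mdist m x y \<le> B"
    using compact_space_mbounded[OF c] by blast
  have B0: "0 \<le> B" using order_trans[OF mdist_nonneg B[OF p p]] .
  have "continuous_map (top_of_set {0..1}) GH_tree_topology (\<lambda>t. isometry_class (trimmed m p (t * B)))"
  proof (rule GH_tree_topology_continuous_mapI)
    fix t e :: real assume t: "t \<in> {0..1}" and e: "0 < e"
    have "GH_dist (trimmed m p (t * B)) (trimmed m p (s * B)) < e"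
      \<comment> \<open>The denominator is \<open>B + 1\<close> because \<open>B\<close> is 0 for a
        one-point space.\<close>
      if s: "s \<in> {0..1}" "dist s t < e / (B + 1)" for s
    proof -
      have "GH_dist (trimmed m p (t * B)) (trimmed m p (s * B)) \<le> \<bar>t * B - s * B\<bar>"
        using s t B0 by (intro GH_dist_trimmed_le tree c p) auto
      also have "\<dots> = dist s t * B"
        using B0 by (simp add: dist_real_def left_diff_distrib[symmetric] abs_mult abs_minus_commute)
      also have "\<dots> \<le> dist s t * (B + 1)" by (simp add: mult_left_mono)
      also have "\<dots> < e" using s(2) B0 by (simp add: field_simps)
      finally show ?thesis .
    qed
    then show "\<exists>d>0. \<forall>s\<in>{0..1}. dist s t < d \<longrightarrow>
        GH_dist (trimmed m p (t * B)) (trimmed m p (s * B)) < e"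
      using e B0 by (intro exI[of _ "e / (B + 1)"]) auto
  next
    fix t :: real assume "t \<in> {0..1}"
    then show "mspace (trimmed m p (t * B)) \<noteq> {}"
      using p B0 by (auto simp: mspace_trimmed intro!: exI[of _ p])
  qed (use compact_space_trimmed[OF c p] metric_tree_trimmed[OF tree p] in auto)
  moreover have "trimmed m p B = m"
  proof -
    have "mspace m \<inter> {x. mdist m p x \<le> B} = mspace m" using B p by auto
    then show ?thesis
      unfolding trimmed_def by (subst submetric_restrict) simp
  qed
  ultimately show ?thesis
    unfolding path_component_of_def pathin_def
    by (intro exI[of _ "\<lambda>t. isometry_class (trimmed m p (t * B))"]) simp
qed

text \<open>All one-point spaces are isometric, so the paths shrinking two trees to points end in
  the same class.\<close>

lemma path_connected_space_GH_tree_topology: "path_connected_space GH_tree_topology"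
  unfolding path_connected_space_iff_path_component topspace_GH_tree_topology
proof (intro ballI)
  fix C D assume "C \<in> GH_trees" "D \<in> GH_trees"
  then obtain m m' :: "univ metric" where
    m: "C = isometry_class m" "mspace m \<noteq> {}" "compact_space (mtopology_of m)" "metric_tree m" and
    m': "D = isometry_class m'" "mspace m' \<noteq> {}" "compact_space (mtopology_of m')" "metric_tree m'"
    unfolding GH_trees_def by auto
  obtain p p' where p: "p \<in> mspace m" "p' \<in> mspace m'" using m(2) m'(2) by auto
  have sing: "mspace (trimmed m p 0) = {p}" "mspace (trimmed m' p' 0) = {p'}"
    using p by (auto simp: mspace_trimmed mdist_le_zero_iff)
  have "isometric (trimmed m p 0) (trimmed m' p' 0)"
    unfolding isometric_def isometric_embedding_def sing
    using p by (intro exI[of _ "\<lambda>_. p'"]) (auto simp: trimmed_def)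
  then have "isometry_class (trimmed m p 0) = isometry_class (trimmed m' p' 0)"
    by (simp add: isometry_class_eq_iff)
  then show "path_component_of GH_tree_topology C D"
    unfolding m(1) m'(1)
    using path_component_of_trans[OF path_component_of_sym[OF path_component_of_point[OF m(4,3) p(1)]]]
      path_component_of_point[OF m'(4,3) p(2)] by simp
qed

section \<open>Attaching segments at a point\<close>

text \<open>The general inequality follows from four instances with the base point \<open>t\<close>.
  For a hyperbolicity constant this change of base point costs a factor 2, which is harmless at
  zero.\<close>

lemma four_pointI_base:
  assumes t: "t \<in> mspace m"
    and base: "\<And>x y z. x \<in> mspace m \<Longrightarrow> y \<in> mspace m \<Longrightarrow> z \<in> mspace m \<Longrightarrow>
      mdist m x y + mdist m z t \<le> max (mdist m x z + mdist m y t) (mdist m x t + mdist m y z)"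
  shows "four_point m"
  unfolding four_point_def
proof (intro ballI)
  fix x y z w assume M: "x \<in> mspace m" "y \<in> mspace m" "z \<in> mspace m" "w \<in> mspace m"
  have "mdist m x y + mdist m z t \<le> max (mdist m x z + mdist m y t) (mdist m x t + mdist m y z)"
    "mdist m x y + mdist m w t \<le> max (mdist m x w + mdist m y t) (mdist m x t + mdist m y w)"
    "mdist m z w + mdist m x t \<le> max (mdist m x z + mdist m w t) (mdist m z t + mdist m x w)"
    "mdist m z w + mdist m y t \<le> max (mdist m y z + mdist m w t) (mdist m z t + mdist m y w)"
    using base[OF M(1,2,3)] base[OF M(1,2,4)] base[OF M(3,4,1)] base[OF M(3,4,2)]
    by (simp_all add: mdist_commute[of m z x] mdist_commute[of m z y] mdist_commute[of m w x]
        mdist_commute[of m w y])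
  then show "mdist m x y + mdist m z w \<le> max (mdist m x z + mdist m y w) (mdist m x w + mdist m y z)"
    unfolding le_max_iff_disj by argo
qed

text \<open>The wedge of \<open>m\<close> with countably many rays at \<open>p\<close>: a path that
  leaves a ray has to pass through \<open>p\<close>.\<close>

fun bouquet_dist :: "('a \<Rightarrow> 'a \<Rightarrow> real) \<Rightarrow> 'a \<Rightarrow> 'a + nat \<times> real \<Rightarrow> 'a + nat \<times> real \<Rightarrow> real" where
  "bouquet_dist d p (Inl x) (Inl y) = d x y"
| "bouquet_dist d p (Inl x) (Inr (i, t)) = d x p + \<bar>t\<bar>"
| "bouquet_dist d p (Inr (i, t)) (Inl x) = d x p + \<bar>t\<bar>"
| "bouquet_dist d p (Inr (i, s)) (Inr (j, t)) = (if i = j then \<bar>s - t\<bar> else \<bar>s\<bar> + \<bar>t\<bar>)"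

text \<open>
  The common starting point of all rays is \<open>Inl p\<close>, hence \<open>0 < t\<close>. The absolute values above
  only matter outside of the carrier, where
  \<^locale>\<open>Metric_space\<close> still requires distances to be nonnegative.
\<close>

definition bouquet :: "'a metric \<Rightarrow> 'a \<Rightarrow> ('a + nat \<times> real) metric" where
  "bouquet m p = metric (Inl ` mspace m \<union> Inr ` {(i, t). 0 < t}, bouquet_dist (mdist m) p)"

lemma Metric_space_bouquet:
  assumes p: "p \<in> mspace m"
  shows "Metric_space (Inl ` mspace m \<union> Inr ` {(i, t). 0 < t}) (bouquet_dist (mdist m) p)"
    (is "Metric_space ?M ?d")
proof
  show "0 \<le> ?d x y" for x y
    by (cases "(mdist m, p, x, y)" rule: bouquet_dist.cases) auto
  show "?d x y = ?d y x" for x y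
    by (cases "(mdist m, p, x, y)" rule: bouquet_dist.cases) (auto simp: mdist_commute)
  have pos: "mdist m x p + t \<noteq> 0" if "0 < t" for x t
    using mdist_nonneg[of m x p] that by linarith
  show "(?d x y = 0) = (x = y)" if "x \<in> ?M" "y \<in> ?M" for x y
    using that pos by (cases "(mdist m, p, x, y)" rule: bouquet_dist.cases) auto
  show "?d x z \<le> ?d x y + ?d y z" if "x \<in> ?M" "y \<in> ?M" "z \<in> ?M" for x y z
  proof -
    have tri: "mdist m a c \<le> mdist m a b + mdist m b c" "mdist m a b \<le> mdist m a p + mdist m b p"
      if "a \<in> mspace m" "b \<in> mspace m" "c \<in> mspace m" for a b c
      using mdist_triangle[of a m b c] mdist_triangle[of a m p b] that p
      by (auto simp: mdist_commute[of m p b])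
    from that consider
      a b c where "x = Inl a" "y = Inl b" "z = Inl c" "a \<in> mspace m" "b \<in> mspace m" "c \<in> mspace m"
    | a b i t where "x = Inl a" "y = Inl b" "z = Inr (i, t)" "a \<in> mspace m" "b \<in> mspace m" "0 < t"
    | a c i t where "x = Inl a" "y = Inr (i, t)" "z = Inl c" "a \<in> mspace m" "c \<in> mspace m" "0 < t"
    | b c i t where "x = Inr (i, t)" "y = Inl b" "z = Inl c" "b \<in> mspace m" "c \<in> mspace m" "0 < t"
    | a i s j t where "x = Inl a" "y = Inr (i, s)" "z = Inr (j, t)" "a \<in> mspace m" "0 < s" "0 < t"
    | b i s j t where "x = Inr (i, s)" "y = Inl b" "z = Inr (j, t)" "b \<in> mspace m" "0 < s" "0 < t"
    | c i s j t where "x = Inr (i, s)" "y = Inr (j, t)" "z = Inl c" "c \<in> mspace m" "0 < s" "0 < t"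
    | i s j t k u where "x = Inr (i, s)" "y = Inr (j, t)" "z = Inr (k, u)" "0 < s" "0 < t" "0 < u"
      by auto
    then show ?thesis
    proof cases
      case 1
      then show ?thesis using tri(1) by simp
    next
      case 2
      then show ?thesis using tri(1)[of a b p] p by simp
    next
      case 3
      then show ?thesis using tri(2)[of a c c] by simp
    next
      case 4
      then show ?thesis using tri(1)[of c b p] p by (simp add: mdist_commute)
    next
      case 6
      then show ?thesis using mdist_nonneg[of m b p] by (simp, linarith)
    qed auto
  qed
qed

lemma mspace_bouquet:
  "p \<in> mspace m \<Longrightarrow> mspace (bouquet m p) = Inl ` mspace m \<union> Inr ` {(i, t). 0 < t}"
  unfolding bouquet_def by (rule Metric_space.mspace_metric[OF Metric_space_bouquet])

lemma mdist_bouquet: "p \<in> mspace m \<Longrightarrow> mdist (bouquet m p) = bouquet_dist (mdist m) p"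
  unfolding bouquet_def by (rule Metric_space.mdist_metric[OF Metric_space_bouquet])

text \<open>Taken inside the fixed space \<open>bouquet m p\<close>, so that stars with different
  leg lengths have a common ambient space.\<close>

definition star :: "'a metric \<Rightarrow> 'a \<Rightarrow> nat \<Rightarrow> (nat \<Rightarrow> real) \<Rightarrow> ('a + nat \<times> real) metric" where
  "star m p M L = submetric (bouquet m p) (Inl ` mspace m \<union> Inr ` {(i, t). i < M \<and> 0 < t \<and> t \<le> L i})"

lemma mspace_star:
  "p \<in> mspace m \<Longrightarrow> mspace (star m p M L) = Inl ` mspace m \<union> Inr ` {(i, t). i < M \<and> 0 < t \<and> t \<le> L i}"
  by (auto simp: star_def mspace_bouquet)

lemma mdist_star: "p \<in> mspace m \<Longrightarrow> mdist (star m p M L) = bouquet_dist (mdist m) p"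
  by (simp add: star_def mdist_bouquet)

lemma isometric_embedding_star:
  assumes "p \<in> mspace m"
  shows "isometric_embedding m (star m p M L) Inl"
    "isometric_embedding m (bouquet m p) Inl"
    "isometric_embedding (star m p M L) (bouquet m p) (\<lambda>x. x)"
  using assms by (auto simp: isometric_embedding_def mspace_star mdist_star mspace_bouquet mdist_bouquet)

text \<open>Adding the attaching point at time 0 makes a half-open leg the isometric image of a
  compact interval.\<close>

definition leg :: "'a \<Rightarrow> nat \<Rightarrow> real \<Rightarrow> 'a + nat \<times> real" where
  "leg p i t = (if t = 0 then Inl p else Inr (i, t))"

lemma unit_speed_leg:
  assumes "p \<in> mspace m" "i < M"
  shows "unit_speed (star m p M L) (L i) (leg p i)"
  using assms by (auto simp: unit_speed_def leg_def mspace_star mdist_star)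

section \<open>Stars are compact trees depending continuously on their leg lengths\<close>

lemma mspace_star_legs:
  assumes "p \<in> mspace m" "\<And>i. i < M \<Longrightarrow> 0 < L i"
  shows "mspace (star m p M L) = Inl ` mspace m \<union> (\<Union>i<M. leg p i ` {0..L i})"
  unfolding mspace_star[OF assms(1)]
proof (intro equalityI subsetI)
  fix x assume "x \<in> Inl ` mspace m \<union> Inr ` {(i, t). i < M \<and> 0 < t \<and> t \<le> L i}"
  then consider "x \<in> Inl ` mspace m" | i t where "x = leg p i t" "i < M" "0 < t" "t \<le> L i"
    by (auto simp: leg_def)
  then show "x \<in> Inl ` mspace m \<union> (\<Union>i<M. leg p i ` {0..L i})"
  proof cases
    case 2
    then have "x \<in> leg p i ` {0..L i}" by simp
    with 2 show ?thesis by blast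
  qed blast
qed (auto simp: leg_def assms(1) split: if_splits)

lemma compact_space_star:
  assumes p: "p \<in> mspace m" and L: "\<And>i. i < M \<Longrightarrow> 0 < L i" and c: "compact_space (mtopology_of m)"
  shows "compact_space (mtopology_of (star m p M L))"
proof -
  let ?S = "star m p M L"
  have X: "compactin (mtopology_of ?S) (Inl ` mspace m)"
    using image_compactin[OF _ isometric_embedding_continuous_map[OF isometric_embedding_star(1)[OF p]],
        of "mspace m"] c by (simp add: compact_space_def)
  have leg: "compactin (mtopology_of ?S) (leg p i ` {0..L i})" if "i < M" for i
  proof -
    have "isometric_embedding (submetric euclidean_metric {0..L i}) ?S (leg p i)"
      using unit_speed_leg[OF p that, of L] by (auto simp: unit_speed_def isometric_embedding_def dist_real_def)
    then have "continuous_map (top_of_set {0..L i}) (mtopology_of ?S) (leg p i)"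
      using isometric_embedding_continuous_map by (fastforce simp: mtopology_of_submetric)
    then show ?thesis
      by (rule image_compactin[rotated]) (simp add: compactin_subtopology)
  qed
  have "compactin (mtopology_of ?S) (\<Union>i<M. leg p i ` {0..L i})"
    using leg by (intro compactin_Union) auto
  then have "compactin (mtopology_of ?S) (mspace ?S)"
    by (subst mspace_star_legs[OF p L]) (assumption, intro compactin_Un X)
  then show ?thesis by (simp add: compact_space_def)
qed

text \<open>With the attaching point as base, three points of \<open>m\<close> reduce to the
  condition in \<open>m\<close>; the remaining cases need at most the triangle inequality.\<close>

lemma four_point_star:
  assumes p: "p \<in> mspace m" and four: "four_point m"
  shows "four_point (star m p M L)"
proof (rule four_pointI_base[of "Inl p"])
  let ?S = "mspace (star m p M L)" and ?d = "mdist (star m p M L)"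
  show "Inl p \<in> ?S" using p by (simp add: mspace_star)
  fix x y z assume "x \<in> ?S" "y \<in> ?S" "z \<in> ?S"
  then consider
    a b c where "x = Inl a" "y = Inl b" "z = Inl c" "a \<in> mspace m" "b \<in> mspace m" "c \<in> mspace m"
  | a b i t where "x = Inl a" "y = Inl b" "z = Inr (i, t)" "a \<in> mspace m" "b \<in> mspace m" "0 < t"
  | a c i t where "x = Inl a" "y = Inr (i, t)" "z = Inl c" "a \<in> mspace m" "c \<in> mspace m" "0 < t"
  | b c i t where "x = Inr (i, t)" "y = Inl b" "z = Inl c" "b \<in> mspace m" "c \<in> mspace m" "0 < t"
  | a i s j t where "x = Inl a" "y = Inr (i, s)" "z = Inr (j, t)" "a \<in> mspace m" "0 < s" "0 < t"
  | b i s j t where "x = Inr (i, s)" "y = Inl b" "z = Inr (j, t)" "b \<in> mspace m" "0 < s" "0 < t"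
  | c i s j t where "x = Inr (i, s)" "y = Inr (j, t)" "z = Inl c" "c \<in> mspace m" "0 < s" "0 < t"
  | i s j t k u where "x = Inr (i, s)" "y = Inr (j, t)" "z = Inr (k, u)" "0 < s" "0 < t" "0 < u"
    unfolding mspace_star[OF p] by auto
  then show "?d x y + ?d z (Inl p) \<le> max (?d x z + ?d y (Inl p)) (?d x (Inl p) + ?d y z)"
  proof cases
    case 1
    then show ?thesis
      using four_pointD[OF four, of a b c p] p by (simp add: mdist_star)
  next
    case 2
    then show ?thesis
      using mdist_triangle[of a m p b] p by (simp add: mdist_star mdist_commute[of m p b])
  qed (use p in \<open>auto simp: mdist_star\<close>)
qed

text \<open>Segments between different pieces are concatenated at the attaching point, through which
  distances add up.\<close>

lemma metric_tree_star:
  assumes p: "p \<in> mspace m" and L: "\<And>i. i < M \<Longrightarrow> 0 < L i" and tree: "metric_tree m"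
  shows "metric_tree (star m p M L)"
proof (rule metric_treeI)
  let ?S = "star m p M L"
  show "four_point ?S"
    using p metric_tree_four_point[OF tree] by (rule four_point_star)
  have leg: "geodesic_segment ?S (leg p i s) (leg p i t) (leg p i ` {s..t})"
    if "i < M" "0 \<le> s" "s \<le> t" "t \<le> L i" for i s t
    using geodesic_segment_sub[OF unit_speed_leg[OF p that(1), of L] that(2-4)] .
  have X: "\<exists>G. geodesic_segment ?S (Inl a) (Inl b) G" if "a \<in> mspace m" "b \<in> mspace m" for a b
    using metric_tree_segment[OF tree that] geodesic_segment_image[OF isometric_embedding_star(1)[OF p]]
    by metis
  have XL: "\<exists>G. geodesic_segment ?S (Inl a) (Inr (i, t)) G"
    if a: "a \<in> mspace m" and i: "i < M" "0 < t" "t \<le> L i" for a i t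
  proof -
    obtain G where G: "geodesic_segment ?S (Inl a) (Inl p) G" using X[OF a p] by blast
    have "geodesic_segment ?S (Inl p) (Inr (i, t)) (leg p i ` {0..t})"
      using leg[of i 0 t] i by (simp add: leg_def)
    from geodesic_segment_concat[OF G this] show ?thesis
      using i p by (auto simp: mdist_star[OF p])
  qed
  have LL: "\<exists>G. geodesic_segment ?S (Inr (i, s)) (Inr (j, t)) G"
    if i: "i < M" "0 < s" "s \<le> L i" and j: "j < M" "0 < t" "t \<le> L j" for i s j t
  proof (cases "i = j")
    case True
    show ?thesis
    proof (cases "s \<le> t")
      case s_le: True
      show ?thesis using leg[of i s t] True i j s_le by (auto simp: leg_def)
    next
      case False
      have "geodesic_segment ?S (Inr (i, t)) (Inr (i, s)) (leg p i ` {t..s})"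
        using leg[of i t s] True i j False by (simp add: leg_def)
      from geodesic_segment_sym[OF this] show ?thesis using True by auto
    qed
  next
    case False
    obtain G where G: "geodesic_segment ?S (Inl p) (Inr (i, s)) G" using XL[OF p i] by blast
    obtain H where H: "geodesic_segment ?S (Inl p) (Inr (j, t)) H" using XL[OF p j] by blast
    from geodesic_segment_concat[OF geodesic_segment_sym[OF G] H] show ?thesis
      using i j p False by (auto simp: mdist_star[OF p])
  qed
  show "geodesic_space ?S"
    unfolding geodesic_space_def
  proof (intro ballI)
    fix x y assume "x \<in> mspace ?S" "y \<in> mspace ?S"
    then consider a b where "x = Inl a" "y = Inl b" "a \<in> mspace m" "b \<in> mspace m"
      | a j t where "x = Inl a" "y = Inr (j, t)" "a \<in> mspace m" "j < M" "0 < t" "t \<le> L j"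
      | a j t where "y = Inl a" "x = Inr (j, t)" "a \<in> mspace m" "j < M" "0 < t" "t \<le> L j"
      | i s j t where "x = Inr (i, s)" "y = Inr (j, t)" "i < M" "0 < s" "s \<le> L i" "j < M" "0 < t" "t \<le> L j"
      unfolding mspace_star[OF p] by auto
    then show "\<exists>G. geodesic_segment ?S x y G"
    proof cases
      case 1
      then show ?thesis using X by simp
    next
      case 2
      then show ?thesis using XL by simp
    next
      case 3
      then obtain G where "geodesic_segment ?S y x G" using XL[of a j t] by auto
      from geodesic_segment_sym[OF this] show ?thesis by blast
    next
      case 4
      then show ?thesis using LL by simp
    qed
  qed
qed

lemma GH_dist_star_le:
  assumes p: "p \<in> mspace m" and c: "compact_space (mtopology_of m)"
    and L: "\<And>i. i < M \<Longrightarrow> 0 < L i" and L': "\<And>i. i < M \<Longrightarrow> 0 < L' i"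
    and near: "\<And>i. i < M \<Longrightarrow> \<bar>L i - L' i\<bar> \<le> e" and e: "0 \<le> e"
  shows "GH_dist (star m p M L) (star m p M L') \<le> e"
proof (rule GH_dist_le[where Z = "bouquet m p" and i = "\<lambda>x. x" and j = "\<lambda>x. x"])
  \<comment> \<open>The estimate is one-sided so as to serve in both directions: a point beyond the
    end of the corresponding leg slides down to its tip, whence the witness with
    \<open>min t (L2 i)\<close>.\<close>
  have close: "\<exists>y\<in>mspace (star m p M L2). mdist (bouquet m p) x y \<le> e"
    if x: "x \<in> mspace (star m p M L1)" and L2: "\<And>i. i < M \<Longrightarrow> 0 < L2 i \<and> L1 i - L2 i \<le> e" for x L1 L2
  proof -
    from x consider a where "x = Inl a" "a \<in> mspace m"
      | i t where "x = Inr (i, t)" "i < M" "0 < t" "t \<le> L1 i"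
      unfolding mspace_star[OF p] by auto
    then show ?thesis
    proof cases
      case 1
      then show ?thesis
        using e by (intro bexI[of _ x]) (auto simp: mspace_star[OF p] mdist_bouquet[OF p])
    next
      case 2
      then show ?thesis
        using e L2[of i]
        by (intro bexI[of _ "Inr (i, min t (L2 i))"]) (auto simp: mspace_star[OF p] mdist_bouquet[OF p])
    qed
  qed
  show "\<exists>y\<in>mspace (star m p M L'). mdist (bouquet m p) x y \<le> e" if "x \<in> mspace (star m p M L)" for x
    by (rule close[OF that]) (use near L' in \<open>auto simp: abs_le_iff\<close>)
  show "\<exists>x\<in>mspace (star m p M L). mdist (bouquet m p) x y \<le> e" if "y \<in> mspace (star m p M L')" for y
    unfolding mdist_commute[of "bouquet m p" _ y]
    by (rule close[OF that]) (use near L in \<open>fastforce simp: abs_le_iff\<close>)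
qed (use p in \<open>auto simp: mspace_star intro!: compact_space_star isometric_embedding_star L L' c\<close>)

lemma GH_dist_star_attached_le:
  assumes p: "p \<in> mspace m" and c: "compact_space (mtopology_of m)"
    and L: "\<And>i. i < M \<Longrightarrow> 0 < L i \<and> L i \<le> e" and e: "0 \<le> e"
  shows "GH_dist m (star m p M L) \<le> e"
proof (rule GH_dist_le[where Z = "bouquet m p" and i = Inl and j = "\<lambda>x. x"])
  show "\<exists>y\<in>mspace (star m p M L). mdist (bouquet m p) (Inl x) y \<le> e" if "x \<in> mspace m" for x
    using that e by (intro bexI[of _ "Inl x"]) (auto simp: mspace_star[OF p] mdist_bouquet[OF p])
  show "\<exists>x\<in>mspace m. mdist (bouquet m p) (Inl x) y \<le> e" if "y \<in> mspace (star m p M L)" for y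
  proof -
    from that consider a where "y = Inl a" "a \<in> mspace m"
      | i t where "y = Inr (i, t)" "i < M" "0 < t" "t \<le> L i"
      unfolding mspace_star[OF p] by auto
    then show ?thesis
    proof cases
      case 1
      then show ?thesis using e by (intro bexI[of _ a]) (auto simp: mdist_bouquet[OF p])
    next
      case 2
      then show ?thesis using e L[of i] p by (intro bexI[of _ p]) (auto simp: mdist_bouquet[OF p])
    qed
  qed
qed (use p in \<open>auto simp: mspace_star intro!: compact_space_star isometric_embedding_star c\<close>, use L in auto)

section \<open>Packing radii\<close>

text \<open>For \<open>r \<le> 0\<close> entries may repeat; constant tuples keep the set in
  \<open>packing_radius\<close> non-empty.\<close>

definition separated_tuple :: "nat \<Rightarrow> 'a metric \<Rightarrow> real \<Rightarrow> (nat \<Rightarrow> 'a) \<Rightarrow> bool" where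
  "separated_tuple k m r x \<longleftrightarrow>
     (\<forall>a<k. x a \<in> mspace m) \<and> (\<forall>a<k. \<forall>b<k. a \<noteq> b \<longrightarrow> r \<le> mdist m (x a) (x b))"

text \<open>Only meaningful for \<open>2 \<le> k\<close>: otherwise the supremum is taken over an unbounded set.\<close>

definition packing_radius :: "nat \<Rightarrow> 'a metric \<Rightarrow> real" where
  "packing_radius k m = Sup {r. 0 \<le> r \<and> (\<exists>x. separated_tuple k m r x)}"

lemma packing_radius_set_nonempty:
  assumes "mspace m \<noteq> {}"
  shows "{r. 0 \<le> r \<and> (\<exists>x. separated_tuple k m r x)} \<noteq> {}"
proof -
  obtain p where "p \<in> mspace m" using assms by auto
  then have "separated_tuple k m 0 (\<lambda>_. p)" by (simp add: separated_tuple_def)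
  then show ?thesis by auto
qed

lemma packing_radius_bdd_above:
  assumes "compact_space (mtopology_of m)" "2 \<le> k"
  shows "bdd_above {r. 0 \<le> r \<and> (\<exists>x. separated_tuple k m r x)}"
proof -
  obtain B where B: "\<And>x y. x \<in> mspace m \<Longrightarrow> y \<in> mspace m \<Longrightarrow> mdist m x y \<le> B"
    using compact_space_mbounded[OF assms(1)] by blast
  have "r \<le> B" if "separated_tuple k m r x" for r x
  proof -
    have "r \<le> mdist m (x 0) (x 1)" "x 0 \<in> mspace m" "x 1 \<in> mspace m"
      using that assms(2) by (auto simp: separated_tuple_def)
    with B show ?thesis by (meson order_trans)
  qed
  then show ?thesis by (intro bdd_aboveI[of _ B]) auto
qed

lemma packing_radius_ge:
  assumes "compact_space (mtopology_of m)" "2 \<le> k" "0 \<le> r" "separated_tuple k m r x"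
  shows "r \<le> packing_radius k m"
  unfolding packing_radius_def
  by (rule cSup_upper) (use packing_radius_bdd_above[OF assms(1,2)] assms(3,4) in auto)

lemma packing_radius_nonneg:
  assumes "compact_space (mtopology_of m)" "2 \<le> k" "mspace m \<noteq> {}"
  shows "0 \<le> packing_radius k m"
proof -
  obtain p where "p \<in> mspace m" using assms by auto
  then have "separated_tuple k m 0 (\<lambda>_. p)" by (simp add: separated_tuple_def)
  then show ?thesis by (intro packing_radius_ge[OF assms(1,2)]) auto
qed

lemma packing_radius_le:
  assumes "mspace m \<noteq> {}" "\<And>r x. 0 \<le> r \<Longrightarrow> separated_tuple k m r x \<Longrightarrow> r \<le> e"
  shows "packing_radius k m \<le> e"
  unfolding packing_radius_def
  by (rule cSup_least[OF packing_radius_set_nonempty[OF assms(1)]]) (use assms(2) in auto)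

text \<open>Replacing each point by one of \<open>Y\<close> at distance less than \<open>e\<close>
  decreases the separation by at most \<open>2 * e\<close>.\<close>

lemma packing_radius_le_ambient:
  assumes cY: "compact_space (mtopology_of Y)" and k: "2 \<le> k"
    and ne: "mspace X \<noteq> {}" "mspace Y \<noteq> {}"
    and i: "isometric_embedding X Z i" and j: "isometric_embedding Y Z j"
    and near: "\<And>x. x \<in> mspace X \<Longrightarrow> \<exists>y\<in>mspace Y. mdist Z (i x) (j y) < e"
  shows "packing_radius k X \<le> packing_radius k Y + 2 * e"
proof (rule packing_radius_le[OF ne(1)])
  fix r x assume r: "0 \<le> r" "separated_tuple k X r x"
  then have x: "a < k \<Longrightarrow> x a \<in> mspace X" "a < k \<Longrightarrow> b < k \<Longrightarrow> a \<noteq> b \<Longrightarrow> r \<le> mdist X (x a) (x b)" for a b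
    by (auto simp: separated_tuple_def)
  have "\<exists>y. a < k \<longrightarrow> y \<in> mspace Y \<and> mdist Z (i (x a)) (j y) < e" for a
    using near[OF x(1)] by blast
  then obtain y where y: "\<And>a. a < k \<Longrightarrow> y a \<in> mspace Y \<and> mdist Z (i (x a)) (j (y a)) < e" by metis
  have "r - 2 * e \<le> mdist Y (y a) (y b)" if ab: "a < k" "b < k" "a \<noteq> b" for a b
  proof -
    have M: "i (x a) \<in> mspace Z" "i (x b) \<in> mspace Z" "j (y a) \<in> mspace Z" "j (y b) \<in> mspace Z"
      using i j x(1) y ab by (auto simp: isometric_embedding_def)
    have "mdist Z (i (x a)) (i (x b)) = mdist X (x a) (x b)" "mdist Z (j (y a)) (j (y b)) = mdist Y (y a) (y b)"
      using i j x(1) y ab by (auto simp: isometric_embedding_def)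
    moreover have "r \<le> mdist X (x a) (x b)" using x(2) ab by blast
    moreover have "mdist Z (i (x a)) (j (y a)) < e" "mdist Z (j (y b)) (i (x b)) < e"
      using y ab by (auto simp: mdist_commute)
    ultimately show ?thesis
      using mdist_triangle[OF M(1,3,2)] mdist_triangle[OF M(3,4,2)] by linarith
  qed
  then have "separated_tuple k Y (r - 2 * e) y"
    using y by (simp add: separated_tuple_def)
  then show "r \<le> packing_radius k Y + 2 * e"
    \<comment> \<open>If \<open>r < 2 * e\<close>, the bound holds because packing radii are
      nonnegative.\<close>
    using packing_radius_ge[OF cY k, of "r - 2 * e" y] packing_radius_nonneg[OF cY k ne(2)]
    by (cases "0 \<le> r - 2 * e") auto
qed

lemma packing_radius_GH_Lipschitz:
  assumes c: "compact_space (mtopology_of X)" "compact_space (mtopology_of Y)"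
    and ne: "mspace X \<noteq> {}" "mspace Y \<noteq> {}" and k: "2 \<le> k" and less: "GH_dist X Y < e"
  shows "\<bar>packing_radius k X - packing_radius k Y\<bar> \<le> 2 * e"
proof -
  obtain Z :: "univ metric" and i j where ij: "isometric_embedding X Z i" "isometric_embedding Y Z j"
    and near: "\<And>x. x \<in> mspace X \<Longrightarrow> \<exists>y\<in>mspace Y. mdist Z (i x) (j y) < e"
      "\<And>y. y \<in> mspace Y \<Longrightarrow> \<exists>x\<in>mspace X. mdist Z (i x) (j y) < e"
    using GH_dist_lessE[OF c ne less] by blast
  have "packing_radius k X \<le> packing_radius k Y + 2 * e"
    using packing_radius_le_ambient[OF c(2) k ne ij near(1)] by blast
  moreover have "packing_radius k Y \<le> packing_radius k X + 2 * e"
    by (rule packing_radius_le_ambient[OF c(1) k ne(2,1) ij(2,1)])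
      (use near(2) in \<open>simp add: mdist_commute\<close>)
  ultimately show ?thesis by linarith
qed

lemma separated_tuple_isometric:
  assumes "isometric m m'" "separated_tuple k m r x"
  shows "\<exists>y. separated_tuple k m' r y"
proof -
  obtain f where f: "isometric_embedding m m' f"
    using assms by (auto simp: isometric_def)
  then have "separated_tuple k m' r (f \<circ> x)"
    using assms(2) by (auto simp: isometric_embedding_def separated_tuple_def)
  then show ?thesis by (rule exI[of _ "f \<circ> x"])
qed

lemma packing_radius_isometric:
  assumes "isometric m m'"
  shows "packing_radius k m = packing_radius k m'"
proof -
  have "(\<exists>x. separated_tuple k m r x) \<longleftrightarrow> (\<exists>x. separated_tuple k m' r x)" for r
    using separated_tuple_isometric[OF assms] separated_tuple_isometric[OF isometric_sym[OF assms]]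
    by metis
  then show ?thesis by (simp add: packing_radius_def)
qed

text \<open>Pigeonhole on a finite cover by balls of radius \<open>c / 2\<close>: two points in the
  same ball are closer than \<open>c\<close>.\<close>

lemma compact_space_packing_number:
  assumes "compact_space (mtopology_of m)" "0 < c"
  obtains P where "\<And>x. \<not> separated_tuple (Suc P) m c x"
proof -
  interpret Metric_space "mspace m" "mdist m" by simp
  have "mtotally_bounded (mspace m)"
    using assms(1) by (simp add: mtopology_of_def compact_space_eq_mcomplete_mtotally_bounded)
  then obtain K where K: "finite K" "K \<subseteq> mspace m" "mspace m \<subseteq> (\<Union>x\<in>K. mball x (c / 2))"
    using assms(2) half_gt_zero unfolding mtotally_bounded_def by metis
  show thesis
  proof (rule that[of "card K"], rule notI)
    fix x assume x: "separated_tuple (Suc (card K)) m c x"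
    have "\<forall>a<Suc (card K). \<exists>u\<in>K. x a \<in> mball u (c / 2)"
      using x K(3) unfolding separated_tuple_def by blast
    then obtain u where u: "\<And>a. a < Suc (card K) \<Longrightarrow> u a \<in> K \<and> x a \<in> mball (u a) (c / 2)" by metis
    have "\<not> inj_on u {..<Suc (card K)}"
      using card_inj_on_le[of u "{..<Suc (card K)}" K] u K(1) by auto
    then obtain a b where ab: "a < Suc (card K)" "b < Suc (card K)" "a \<noteq> b" "u a = u b"
      by (auto simp: inj_on_def)
    have "x a \<in> mball (u a) (c / 2)" "x b \<in> mball (u a) (c / 2)"
      using u[OF ab(1)] u[OF ab(2)] ab(4) by auto
    then have "mdist m (x a) (x b) < c"
      using triangle[of "x a" "u a" "x b"] by (auto simp: commute)
    moreover have "c \<le> mdist m (x a) (x b)"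
      using x ab by (simp add: separated_tuple_def)
    ultimately show False by simp
  qed
qed

lemma separated_tuple_subset_card:
  assumes P: "\<And>x. \<not> separated_tuple (Suc P) m c x" and A: "finite A"
    and x: "\<And>a. a \<in> A \<Longrightarrow> x a \<in> mspace m" "\<And>a b. a \<in> A \<Longrightarrow> b \<in> A \<Longrightarrow> a \<noteq> b \<Longrightarrow> c \<le> mdist m (x a) (x b)"
  shows "card A \<le> P"
proof (rule ccontr)
  assume "\<not> card A \<le> P"
  then have le: "Suc P \<le> card A" by simp
  obtain h where h: "bij_betw h {0..<card A} A"
    using ex_bij_betw_nat_finite[OF A] by blast
  then have hA: "h a \<in> A" if "a < Suc P" for a
    using that le by (auto simp: bij_betw_def)
  have inj: "h a \<noteq> h b" if "a < Suc P" "b < Suc P" "a \<noteq> b" for a b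
    using h that le by (auto simp: bij_betw_def inj_on_def)
  have "separated_tuple (Suc P) m c (x \<circ> h)"
    using x hA inj by (simp add: separated_tuple_def)
  then show False using P by blast
qed

text \<open>
  Apart from the points of \<open>m\<close> itself, a separated tuple has at most one point on each leg, and at
  most one point in the union of all legs that are shorter than \<open>r / 2\<close>.
\<close>

lemma separated_tuple_star_le:
  assumes p: "p \<in> mspace m" and P: "\<And>x. \<not> separated_tuple (Suc P) m c x"
    and L: "\<And>i. i < M \<Longrightarrow> L i \<le> r" and r: "c \<le> r"
    and x: "separated_tuple k (star m p M L) r x"
  shows "k \<le> P + 1 + card {i. i < M \<and> r \<le> 2 * L i}"
proof -
  let ?d = "bouquet_dist (mdist m) p"
  have xM: "x a \<in> Inl ` mspace m \<union> Inr ` {(i, t). i < M \<and> 0 < t \<and> t \<le> L i}" if "a < k" for a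
    using x that mspace_star[OF p, of M L] unfolding separated_tuple_def by blast
  have xd: "r \<le> ?d (x a) (x b)" if "a < k" "b < k" "a \<noteq> b" for a b
    using x that mdist_star[OF p, of M L] unfolding separated_tuple_def by simp
  \<comment> \<open>The indices are split according to points in \<open>m\<close>, on long legs and
    on short legs.\<close>
  define A where "A = {a. a < k \<and> x a \<in> Inl ` mspace m}"
  define B where "B = {a. a < k \<and> (\<exists>i t. x a = Inr (i, t) \<and> i < M \<and> 0 < t \<and> t \<le> L i \<and> r \<le> 2 * L i)}"
  define C where "C = {a. a < k \<and> (\<exists>i t. x a = Inr (i, t) \<and> i < M \<and> 0 < t \<and> t \<le> L i \<and> 2 * L i < r)}"
  have fin: "finite A" "finite B" "finite C" by (auto simp: A_def B_def C_def)
  have "{..<k} \<subseteq> A \<union> B \<union> C"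
  proof
    fix a assume "a \<in> {..<k}"
    then show "a \<in> A \<union> B \<union> C"
      using xM[of a] by (fastforce simp: A_def B_def C_def not_le)
  qed
  then have "k \<le> card (A \<union> B \<union> C)"
    using card_mono[of "A \<union> B \<union> C" "{..<k}"] fin by simp
  also have "\<dots> \<le> card A + card B + card C"
    using card_Un_le[of "A \<union> B" C] card_Un_le[of A B] by linarith
  finally have k: "k \<le> card A + card B + card C" .
  have "card A \<le> P"
  proof (rule separated_tuple_subset_card[OF P fin(1)])
    have Inl_A: "\<exists>u\<in>mspace m. x a = Inl u" if "a \<in> A" for a
      using that by (auto simp: A_def)
    show "projl (x a) \<in> mspace m" if "a \<in> A" for a
      using Inl_A[OF that] by auto
    show "c \<le> mdist m (projl (x a)) (projl (x b))" if "a \<in> A" "b \<in> A" "a \<noteq> b" for a b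
      using Inl_A[OF that(1)] Inl_A[OF that(2)] xd[of a b] that r by (auto simp: A_def)
  qed
  \<comment> \<open>Two points of one leg are at distance less than \<open>L i \<le> r\<close>, so
    long legs carry at most one point each.\<close>
  moreover have "card B \<le> card {i. i < M \<and> r \<le> 2 * L i}"
  proof (rule card_inj_on_le[of "\<lambda>a. fst (projr (x a))"])
    show "inj_on (\<lambda>a. fst (projr (x a))) B"
    proof (rule inj_onI, rule ccontr)
      fix a b assume ab: "a \<in> B" "b \<in> B" "fst (projr (x a)) = fst (projr (x b))" "a \<noteq> b"
      then obtain i s t where "x a = Inr (i, s)" "x b = Inr (i, t)" "i < M" "0 < s" "s \<le> L i" "0 < t" "t \<le> L i"
        unfolding B_def by auto
      then show False
        using xd[of a b] ab L[of i] by (auto simp: B_def)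
    qed
  qed (auto simp: B_def)
  \<comment> \<open>On short legs both points are closer than \<open>r / 2\<close> to
    \<open>p\<close>.\<close>
  moreover have "card C \<le> 1"
  proof -
    have "a = b" if ab: "a \<in> C" "b \<in> C" for a b
    proof (rule ccontr)
      assume "a \<noteq> b"
      moreover obtain i s j t where "x a = Inr (i, s)" "x b = Inr (j, t)" "0 < s" "s \<le> L i" "0 < t" "t \<le> L j"
        "2 * L i < r" "2 * L j < r" "a < k" "b < k"
        using ab unfolding C_def by auto
      ultimately show False
        using xd[of a b] by (auto split: if_splits)
    qed
    then show ?thesis using card_le_Suc0_iff_eq[OF fin(3)] by auto
  qed
  ultimately show ?thesis using k by linarith
qed

text \<open>
  The legs come in groups of \<open>K\<close> equal ones. As \<open>K\<close> exceeds the packing number of \<open>m\<close> at the scale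
  of the legs, the length of each group can be read off exactly.
\<close>

lemma packing_radius_star:
  fixes l :: "nat \<Rightarrow> real"
  assumes p: "p \<in> mspace m" and c: "compact_space (mtopology_of m)"
    and P: "\<And>x. \<not> separated_tuple (Suc P) m c x" and K: "K = P + 2" and c0: "0 < c"
    and l: "\<And>j. j < N \<Longrightarrow> c \<le> l j \<and> l j \<le> 2 * c" and mono: "\<And>i j. i \<le> j \<Longrightarrow> j < N \<Longrightarrow> l j \<le> l i"
    and j: "j < N"
  shows "packing_radius (Suc j * K) (star m p (N * K) (\<lambda>i. l (i div K))) = 2 * l j"
proof (rule antisym)
  let ?L = "\<lambda>i. l (i div K)" and ?M = "N * K"
  have K0: "0 < K" using K by simp
  have group: "i div K < N" if "i < ?M" for i
    using that by (simp add: less_mult_imp_div_less)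
  have L0: "0 < ?L i" if "i < ?M" for i
    using l[OF group[OF that]] c0 by linarith
  have k2: "2 \<le> Suc j * K" using K by simp
  show "2 * l j \<le> packing_radius (Suc j * K) (star m p ?M ?L)"
  \<comment> \<open>The groups are numbered from 0, so groups 0 to \<open>j\<close> have
    \<open>Suc j * K\<close> legs. Their tips are separated by sums of two lengths, each at least
    \<open>l j\<close> by monotonicity.\<close>
  proof (rule packing_radius_ge[OF compact_space_star[OF p L0 c] k2])
    have a: "a < ?M \<and> l j \<le> ?L a" if "a < Suc j * K" for a
    proof
      have "a div K < Suc j" using that by (simp only: less_mult_imp_div_less)
      then show "l j \<le> ?L a" using mono[of "a div K" j] j by simp
      have "Suc j * K \<le> N * K" using j by (intro mult_le_mono1) simp
      then show "a < ?M" using that by linarith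
    qed
    then show "separated_tuple (Suc j * K) (star m p ?M ?L) (2 * l j) (\<lambda>a. Inr (a, ?L a))"
      unfolding separated_tuple_def mdist_star[OF p] mspace_star[OF p]
    proof (intro conjI allI impI)
      fix a b assume "a < Suc j * K" "b < Suc j * K" "a \<noteq> b"
      then show "2 * l j \<le> bouquet_dist (mdist m) p (Inr (a, ?L a)) (Inr (b, ?L b))"
        using a[of a] a[of b] L0[of a] L0[of b] by simp
    qed (use L0 in auto)
    show "0 \<le> 2 * l j" using l[OF j] c0 by linarith
  qed
  show "packing_radius (Suc j * K) (star m p ?M ?L) \<le> 2 * l j"
  proof (rule packing_radius_le)
    show "mspace (star m p ?M ?L) \<noteq> {}" using p by (auto simp: mspace_star[OF p])
    fix r x assume x: "separated_tuple (Suc j * K) (star m p ?M ?L) r x"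
    show "r \<le> 2 * l j"
    proof (rule ccontr)
      assume r: "\<not> r \<le> 2 * l j"
      have le: "Suc j * K \<le> P + 1 + card {i. i < ?M \<and> r \<le> 2 * ?L i}"
      proof (rule separated_tuple_star_le[OF p P _ _ x])
        show "c \<le> r" using r l[OF j] c0 by linarith
        \<comment> \<open>The range \<open>c\<close> to \<open>2 * c\<close> of the lengths matters
          here: every leg is at most \<open>2 * c \<le> 2 * l j < r\<close>.\<close>
        show "?L i \<le> r" if "i < ?M" for i
          using r l[OF j] l[OF group[OF that]] by linarith
      qed
      \<comment> \<open>Only legs in groups before \<open>j\<close> can be long. Then
        \<open>Suc j * K \<le> P + 1 + j * K\<close>, contrary to \<open>K = P + 2\<close>.\<close>
      have "{i. i < ?M \<and> r \<le> 2 * ?L i} \<subseteq> {..<j * K}"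
      proof
        fix i assume i: "i \<in> {i. i < ?M \<and> r \<le> 2 * ?L i}"
        then have "l j < ?L i" using r by simp
        then have "\<not> j \<le> i div K" using mono[of j "i div K"] group[of i] i by auto
        then show "i \<in> {..<j * K}" using K0 by (simp add: div_less_iff_less_mult not_le)
      qed
      then have "card {i. i < ?M \<and> r \<le> 2 * ?L i} \<le> j * K"
        using card_mono[of "{..<j * K}"] by fastforce
      then show False using K le by simp
    qed
  qed
qed

section \<open>Covering dimension of spaces retracting onto a cube\<close>

text \<open>Points are sequences vanishing from \<open>N\<close> on, so the dimension is an ordinary
  variable and compactness comes from Tychonoff's theorem.\<close>

definition cube :: "nat \<Rightarrow> (nat \<Rightarrow> real) set" where
  "cube N = {x. (\<forall>i<N. 0 \<le> x i \<and> x i \<le> 1) \<and> (\<forall>i\<ge>N. x i = 0)}"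

lemma compact_cube: "compact (cube N)"
proof -
  have "cube N = (\<Pi>\<^sub>E i\<in>UNIV. if i < N then {0..1} else {0})"
    by (auto simp: cube_def PiE_def Pi_iff split: if_splits)
  moreover have "compactin (product_topology (\<lambda>_. euclideanreal) UNIV)
      (\<Pi>\<^sub>E i\<in>(UNIV::nat set). if i < N then {0..1} else {0})"
    by (subst compactin_PiE) auto
  ultimately show ?thesis
    by (simp add: euclidean_product_topology)
qed

section \<open>The Poincare--Miranda theorem from Kuhn's combinatorial lemma\<close>

lemma tendsto_fun_componentwise:
  fixes f :: "'c \<Rightarrow> nat \<Rightarrow> real"
  assumes "\<And>i. ((\<lambda>n. f n i) \<longlongrightarrow> l i) F"
  shows "(f \<longlongrightarrow> l) F"
proof -
  have "limitin (product_topology (\<lambda>_. euclideanreal) UNIV) f l F"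
    unfolding limitin_componentwise using assms by auto
  then show ?thesis by (simp add: euclidean_product_topology)
qed

lemma poincare_miranda_cube_approx:
  fixes f :: "nat \<Rightarrow> (nat \<Rightarrow> real) \<Rightarrow> real" and k :: nat
  assumes lo: "\<And>i x. i < N \<Longrightarrow> x \<in> cube N \<Longrightarrow> x i = 0 \<Longrightarrow> f i x \<le> 0"
    and hi: "\<And>i x. i < N \<Longrightarrow> x \<in> cube N \<Longrightarrow> x i = 1 \<Longrightarrow> 0 \<le> f i x"
  shows "\<exists>z. z \<in> cube N \<and> (\<forall>i<N. \<exists>u v. u \<in> cube N \<and> v \<in> cube N \<and> f i u \<le> 0 \<and> 0 \<le> f i v \<and>
           (\<forall>j. \<bar>u j - z j\<bar> \<le> 1 / real (Suc k)) \<and> (\<forall>j. \<bar>v j - z j\<bar> \<le> 1 / real (Suc k)))"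
proof -
  let ?p = "Suc k"
  define pt where "pt x = (\<lambda>i. if i < N then real (x i) / real ?p else 0)" for x :: "nat \<Rightarrow> nat"
  \<comment> \<open>The label records the sign of \<open>f i\<close>, except that it is forced to 0
    and 1 on opposite faces as Kuhn's lemma requires; there \<open>lo\<close> and \<open>hi\<close>
    give the matching weak inequality.\<close>
  define label where "label x i = (if x i = ?p \<or> x i \<noteq> 0 \<and> 0 < f i (pt x) then 1 else (0::nat))" for x i
  have pt_cube: "pt x \<in> cube N" if "\<forall>i<N. x i \<le> ?p" for x
    using that by (auto simp: pt_def cube_def)
  obtain q where q: "\<forall>i<N. q i < ?p"
    and rs: "\<forall>i<N. \<exists>r s. (\<forall>j<N. q j \<le> r j \<and> r j \<le> q j + 1) \<and>
      (\<forall>j<N. q j \<le> s j \<and> s j \<le> q j + 1) \<and> label r i \<noteq> label s i"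
    by (rule kuhn_lemma[of ?p N label]) (auto simp: label_def)
  have low: "f i (pt x) \<le> 0" if "i < N" "\<forall>i<N. x i \<le> ?p" "label x i = 0" for i x
    using that lo[of i "pt x"] pt_cube[of x] by (auto simp: label_def pt_def split: if_splits)
  have high: "0 \<le> f i (pt x)" if "i < N" "\<forall>i<N. x i \<le> ?p" "label x i = 1" for i x
    using that hi[of i "pt x"] pt_cube[of x] by (auto simp: label_def pt_def split: if_splits)
  have near: "\<bar>pt r j - pt q j\<bar> \<le> 1 / real ?p" if "\<forall>j<N. q j \<le> r j \<and> r j \<le> q j + 1" for r j
  proof (cases "j < N")
    case True
    then have "q j \<le> r j" "r j \<le> q j + 1" using that by auto
    then have "\<bar>real (r j) - real (q j)\<bar> \<le> 1" by linarith
    then show ?thesis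
      using True by (simp add: pt_def diff_divide_distrib[symmetric] abs_divide divide_right_mono)
  qed (simp add: pt_def)
  have "pt q \<in> cube N" using q by (intro pt_cube) (auto intro: less_imp_le)
  moreover have "\<forall>i<N. \<exists>u v. u \<in> cube N \<and> v \<in> cube N \<and> f i u \<le> 0 \<and> 0 \<le> f i v \<and>
      (\<forall>j. \<bar>u j - pt q j\<bar> \<le> 1 / real ?p) \<and> (\<forall>j. \<bar>v j - pt q j\<bar> \<le> 1 / real ?p)"
  proof (intro allI impI)
    fix i assume i: "i < N"
    then obtain r s where r: "\<forall>j<N. q j \<le> r j \<and> r j \<le> q j + 1"
      and s: "\<forall>j<N. q j \<le> s j \<and> s j \<le> q j + 1" and lab: "label r i \<noteq> label s i"
      using rs by blast
    have le: "\<forall>j<N. r j \<le> ?p" "\<forall>j<N. s j \<le> ?p"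
      using r s q by (metis Suc_eq_plus1 Suc_leI order_trans)+
    have "label r i = 0 \<and> label s i = 1 \<or> label r i = 1 \<and> label s i = 0"
      using lab by (auto simp: label_def split: if_splits)
    then show "\<exists>u v. u \<in> cube N \<and> v \<in> cube N \<and> f i u \<le> 0 \<and> 0 \<le> f i v \<and>
        (\<forall>j. \<bar>u j - pt q j\<bar> \<le> 1 / real ?p) \<and> (\<forall>j. \<bar>v j - pt q j\<bar> \<le> 1 / real ?p)"
    proof
      assume "label r i = 0 \<and> label s i = 1"
      then show ?thesis
        using low[OF i le(1)] high[OF i le(2)] near[OF r] near[OF s] pt_cube le by blast
    next
      assume "label r i = 1 \<and> label s i = 0"
      then show ?thesis
        using low[OF i le(2)] high[OF i le(1)] near[OF r] near[OF s] pt_cube le by blast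
    qed
  qed
  ultimately show ?thesis by (intro exI[of _ "pt q"] conjI)
qed

text \<open>As the mesh tends to 0, the grid points subconverge to some \<open>l\<close>, and so do
  the nearby points where \<open>f i\<close> has either sign; by continuity \<open>f i l\<close> is
  both nonpositive and nonnegative.\<close>

lemma poincare_miranda_cube:
  fixes f :: "nat \<Rightarrow> (nat \<Rightarrow> real) \<Rightarrow> real"
  assumes cont: "\<And>i. i < N \<Longrightarrow> continuous_on (cube N) (f i)"
    and lo: "\<And>i x. i < N \<Longrightarrow> x \<in> cube N \<Longrightarrow> x i = 0 \<Longrightarrow> f i x \<le> 0"
    and hi: "\<And>i x. i < N \<Longrightarrow> x \<in> cube N \<Longrightarrow> x i = 1 \<Longrightarrow> 0 \<le> f i x"
  obtains x where "x \<in> cube N" "\<And>i. i < N \<Longrightarrow> f i x = 0"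
proof -
  define near where "near k z i u v \<longleftrightarrow> u \<in> cube N \<and> v \<in> cube N \<and> f i u \<le> 0 \<and> 0 \<le> f i v \<and>
    (\<forall>j. \<bar>u j - z j\<bar> \<le> 1 / real (Suc k)) \<and> (\<forall>j. \<bar>v j - z j\<bar> \<le> 1 / real (Suc k))" for k z i u v
  have "\<exists>z. z \<in> cube N \<and> (\<forall>i<N. \<exists>u v. near k z i u v)" for k
    unfolding near_def by (rule poincare_miranda_cube_approx[OF lo hi])
  then obtain z where z: "\<And>k. z k \<in> cube N" and zi: "\<And>k i. i < N \<Longrightarrow> \<exists>u v. near k (z k) i u v"
    by metis
  obtain l r where l: "l \<in> cube N" "strict_mono r" "(z \<circ> r) \<longlonglongrightarrow> l"
    using compact_cube[of N] z unfolding compact_def by blast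
  have zl: "(\<lambda>n. z (r n) j) \<longlonglongrightarrow> l j" for j
  proof -
    have "isCont (\<lambda>x::nat \<Rightarrow> real. x j) l"
      by (rule continuous_on_interior[of UNIV]) (auto intro: continuous_on_product_coordinates)
    then show ?thesis
      using isCont_tendsto_compose[OF _ l(3)] by (simp add: o_def)
  qed
  have close: "w \<longlonglongrightarrow> l" if w: "\<And>n j. \<bar>w n j - z (r n) j\<bar> \<le> 1 / real (Suc (r n))" for w
  proof (rule tendsto_fun_componentwise)
    fix j
    have "(\<lambda>n. 1 / real (Suc (r n))) \<longlonglongrightarrow> 0"
      using LIMSEQ_subseq_LIMSEQ[OF LIMSEQ_inverse_real_of_nat l(2)] by (simp add: o_def inverse_eq_divide)
    then have "(\<lambda>n. w n j - z (r n) j) \<longlonglongrightarrow> 0"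
      by (rule Lim_null_comparison[rotated]) (simp add: w del: of_nat_Suc)
    then show "(\<lambda>n. w n j) \<longlonglongrightarrow> l j"
      using tendsto_add[OF _ zl[of j]] by fastforce
  qed
  have "f i l = 0" if i: "i < N" for i
  proof -
    obtain u v where "\<And>k. near k (z k) i (u k) (v k)"
      using zi[OF i] by metis
    then have uv: "\<And>k. u k \<in> cube N" "\<And>k. v k \<in> cube N" "\<And>k. f i (u k) \<le> 0" "\<And>k. 0 \<le> f i (v k)"
      "\<And>k j. \<bar>u k j - z k j\<bar> \<le> 1 / real (Suc k)" "\<And>k j. \<bar>v k j - z k j\<bar> \<le> 1 / real (Suc k)"
      by (simp_all add: near_def)
    have lim: "(\<lambda>n. f i (w (r n))) \<longlonglongrightarrow> f i l"
      if "\<And>k. w k \<in> cube N" "\<And>k j. \<bar>w k j - z k j\<bar> \<le> 1 / real (Suc k)" for w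
      by (rule continuous_on_tendsto_compose[OF cont[OF i] close l(1)]) (auto simp: that simp del: of_nat_Suc)
    have "f i l \<le> 0"
      by (rule LIMSEQ_le_const2[OF lim[OF uv(1,5)]]) (simp add: uv(3))
    moreover have "0 \<le> f i l"
      by (rule LIMSEQ_le_const[OF lim[OF uv(2,6)]]) (simp add: uv(4))
    ultimately show ?thesis by simp
  qed
  with l(1) show thesis by (rule that)
qed

text \<open>A refinement of order \<open>n + 1\<close> is pulled back along \<open>\<sigma>\<close>,
  and the partition of unity is taken on the cube. At one point there are at most
  \<open>2 ^ (n + 1)\<close> subsums, too few for \<open>N\<close> different values.\<close>

lemma covering_dim_gt_cube_retract:
  assumes \<sigma>: "continuous_map (top_of_set (cube N)) T \<sigma>"
    and F: "\<And>j. j < N \<Longrightarrow> continuous_map T euclideanreal (F j)"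
    and inv: "\<And>j x. j < N \<Longrightarrow> x \<in> cube N \<Longrightarrow> F j (\<sigma> x) = x j"
    and N: "2 ^ nat (n + 1) < N"
  shows "\<not> covering_dim_le T n"
proof
  assume dim: "covering_dim_le T n"
  \<comment> \<open>\<open>U e\<close> avoids the zero face of coordinate \<open>j\<close> for
    \<open>j \<in> e\<close> and the opposite face for all other \<open>j < N\<close>.\<close>
  define U where "U e = (\<Inter>j<N. {t \<in> topspace T. F j t \<in> (if j \<in> e then {0<..} else {..<1})})" for e :: "nat set"
  have "N \<noteq> 0" using N by auto
  then have ne: "{..<N} \<noteq> {}" by auto
  have U_iff: "t \<in> U e \<longleftrightarrow> t \<in> topspace T \<and> (\<forall>j<N. if j \<in> e then 0 < F j t else F j t < 1)" for t e
    using ne by (auto simp: U_def split: if_splits)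
  have "openin T {t \<in> topspace T. F j t \<in> (if j \<in> e then {0<..} else {..<1})}" if "j < N" for j e
    using F[OF that] by (rule openin_continuous_map_preimage) simp
  then have U_open: "openin T (U e)" for e
    unfolding U_def using ne by (intro openin_Inter) auto
  have U_cover: "\<Union>(U ` Pow {..<N}) = topspace T"
  proof
    show "\<Union>(U ` Pow {..<N}) \<subseteq> topspace T" by (auto simp: U_iff)
    show "topspace T \<subseteq> \<Union>(U ` Pow {..<N})"
    proof
      fix t assume "t \<in> topspace T"
      then have "t \<in> U {j. j < N \<and> 0 < F j t}" by (auto simp: U_iff)
      then show "t \<in> \<Union>(U ` Pow {..<N})" by (rule UN_I[rotated]) auto
    qed
  qed
  have "\<exists>\<V>. finite \<V> \<and> (\<forall>V\<in>\<V>. openin T V) \<and> \<Union>\<V> = topspace T \<and>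
             (\<forall>V\<in>\<V>. \<exists>U'\<in>U ` Pow {..<N}. V \<subseteq> U') \<and>
             (\<forall>x\<in>topspace T. int (card {V \<in> \<V>. x \<in> V}) \<le> n + 1)"
    using dim U_cover U_open unfolding covering_dim_le_def by (elim allE[of _ "U ` Pow {..<N}"]) auto
  then obtain \<V> where \<V>: "finite \<V>" "\<forall>V\<in>\<V>. openin T V" "\<Union>\<V> = topspace T"
    "\<forall>V\<in>\<V>. \<exists>U'\<in>U ` Pow {..<N}. V \<subseteq> U'" "\<forall>x\<in>topspace T. int (card {V \<in> \<V>. x \<in> V}) \<le> n + 1"
    by (elim exE conjE) (rule that)
  have "\<forall>V\<in>\<V>. \<exists>e. V \<subseteq> U e" using \<V>(4) by fast
  then obtain e where e: "\<And>V. V \<in> \<V> \<Longrightarrow> V \<subseteq> U (e V)" by metis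
  \<comment> \<open>The partition of unity is indexed by open sets of the whole function space, so
    the preimages are extended beyond the cube.\<close>
  have "\<exists>W. open W \<and> {x \<in> cube N. \<sigma> x \<in> V} = cube N \<inter> W" if "V \<in> \<V>" for V
    using openin_continuous_map_preimage[OF \<sigma> bspec[OF \<V>(2) that]] by (simp add: openin_open)
  then obtain W where W: "\<And>V. V \<in> \<V> \<Longrightarrow> open (W V)"
    "\<And>V. V \<in> \<V> \<Longrightarrow> {x \<in> cube N. \<sigma> x \<in> V} = cube N \<inter> W V" by metis
  have W_iff: "x \<in> W V \<longleftrightarrow> \<sigma> x \<in> V" if "V \<in> \<V>" "x \<in> cube N" for x V
    using W(2)[OF that(1)] that(2) by blast
  define C where "C = W ` \<V>"
  \<comment> \<open>\<open>W\<close> may identify members of \<open>\<V>\<close>; any representative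
    will do, since \<open>W V\<close> determines the preimage of \<open>V\<close> in the
    cube.\<close>
  define e' where "e' c = e (inv_into \<V> W c)" for c
  have fin_C: "finite C" using \<V>(1) by (simp add: C_def)
  have \<sigma>_top: "\<sigma> x \<in> topspace T" if "x \<in> cube N" for x
    using \<sigma> that by (auto simp: continuous_map_def)
  have in_U: "\<sigma> x \<in> U (e' c)" if "c \<in> C" "x \<in> cube N" "x \<in> c" for c x
  proof -
    have "inv_into \<V> W c \<in> \<V>" "W (inv_into \<V> W c) = c"
      using that(1) by (auto simp: C_def inv_into_into f_inv_into_f)
    then show ?thesis
      using W_iff[of "inv_into \<V> W c" x] e that unfolding e'_def by blast
  qed
  have C_cover: "cube N \<subseteq> \<Union>C"
  proof
    fix x assume x: "x \<in> cube N"
    obtain V where V: "V \<in> \<V>" "\<sigma> x \<in> V" using \<V>(3) \<sigma>_top[OF x] by auto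
    then have "x \<in> W V" using W_iff[OF V(1) x] by simp
    then show "x \<in> \<Union>C" using V(1) by (auto simp: C_def)
  qed
  have C_open: "open c" if "c \<in> C" for c
    using that W(1) by (auto simp: C_def)
  have C_locfin: "\<exists>V. open V \<and> x \<in> V \<and> finite {c \<in> C. c \<inter> V \<noteq> {}}" for x :: "nat \<Rightarrow> real"
    using fin_C by (intro exI[of _ UNIV]) auto
  obtain \<phi> :: "(nat \<Rightarrow> real) set \<Rightarrow> (nat \<Rightarrow> real) \<Rightarrow> real" where
    \<phi>: "\<And>c. c \<in> C \<Longrightarrow> continuous_on (cube N) (\<phi> c) \<and> (\<forall>x\<in>cube N. 0 \<le> \<phi> c x)"
      "\<And>x c. c \<in> C \<Longrightarrow> x \<in> cube N \<Longrightarrow> x \<notin> c \<Longrightarrow> \<phi> c x = 0"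
      "\<And>x. x \<in> cube N \<Longrightarrow> supp_sum (\<lambda>c. \<phi> c x) C = 1"
  proof (rule subordinate_partition_of_unity[OF C_cover C_open C_locfin], assumption)
    fix F :: "(nat \<Rightarrow> real) set \<Rightarrow> (nat \<Rightarrow> real) \<Rightarrow> real"
    assume "\<And>c. c \<in> C \<Longrightarrow> continuous_on (cube N) (F c) \<and> (\<forall>x\<in>cube N. 0 \<le> F c x)"
      "\<And>x c. c \<in> C \<Longrightarrow> x \<in> cube N \<Longrightarrow> x \<notin> c \<Longrightarrow> F c x = 0"
      "\<And>x. x \<in> cube N \<Longrightarrow> supp_sum (\<lambda>c. F c x) C = 1"
    then show thesis by (rule that)
  qed
  have \<phi>_sum: "(\<Sum>c\<in>C. \<phi> c x) = 1" if "x \<in> cube N" for x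
  proof -
    have "supp_sum (\<lambda>c. \<phi> c x) C = (\<Sum>c\<in>C. \<phi> c x)"
      unfolding supp_sum_def support_on_def by (rule sum.mono_neutral_left) (use fin_C in auto)
    then show ?thesis using \<phi>(3)[OF that] by simp
  qed
  \<comment> \<open>On the face with coordinate \<open>j\<close> equal to 0 every summand of
    \<open>g j\<close> vanishes; on the opposite face every omitted member of the partition
    does.\<close>
  define g where "g j x = (\<Sum>c\<in>C. if j \<in> e' c then \<phi> c x else 0)" for j x
  have g0: "g j x = 0" if "j < N" "x \<in> cube N" "x j = 0" for j x
    unfolding g_def
  proof (rule sum.neutral, rule ballI)
    fix c assume c: "c \<in> C"
    have "\<phi> c x = 0" if j: "j \<in> e' c"
      using in_U[OF c \<open>x \<in> cube N\<close>] inv[OF \<open>j < N\<close> \<open>x \<in> cube N\<close>] \<phi>(2)[OF c \<open>x \<in> cube N\<close>]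
        \<open>x j = 0\<close> \<open>j < N\<close> j by (fastforce simp: U_iff)
    then show "(if j \<in> e' c then \<phi> c x else 0) = 0" by simp
  qed
  have g1: "g j x = 1" if "j < N" "x \<in> cube N" "x j = 1" for j x
  proof -
    have "g j x = (\<Sum>c\<in>C. \<phi> c x)"
      unfolding g_def
    proof (rule sum.cong[OF refl])
      fix c assume c: "c \<in> C"
      have "\<phi> c x = 0" if j: "j \<notin> e' c"
        using in_U[OF c \<open>x \<in> cube N\<close>] inv[OF \<open>j < N\<close> \<open>x \<in> cube N\<close>] \<phi>(2)[OF c \<open>x \<in> cube N\<close>]
          \<open>x j = 1\<close> \<open>j < N\<close> j by (fastforce simp: U_iff)
      then show "(if j \<in> e' c then \<phi> c x else 0) = \<phi> c x" by simp
    qed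
    then show ?thesis using \<phi>_sum that by simp
  qed
  \<comment> \<open>These are \<open>N\<close> distinct values strictly between 0 and 1; the two
    \<open>Suc\<close> exclude the ends.\<close>
  define y where "y j = real (Suc j) / real (Suc N)" for j
  have y: "0 \<le> y j" "j < N \<Longrightarrow> y j \<le> 1" "y j = y k \<Longrightarrow> j = k" for j k
    by (auto simp: y_def)
  have cont_g: "continuous_on (cube N) (\<lambda>x. g j x - y j)" for j
  proof -
    have "continuous_on (cube N) (\<lambda>x. if j \<in> e' c then \<phi> c x else 0)" if "c \<in> C" for c
      using \<phi>(1)[OF that] by (cases "j \<in> e' c") auto
    then show ?thesis
      unfolding g_def by (intro continuous_intros) auto
  qed
  obtain x where x: "x \<in> cube N" "\<And>j. j < N \<Longrightarrow> g j x - y j = 0"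
    by (rule poincare_miranda_cube[of N "\<lambda>j x. g j x - y j", OF cont_g]) (use g0 g1 y in auto)
  define S where "S = {c \<in> C. x \<in> c}"
  have "S \<subseteq> W ` {V \<in> \<V>. \<sigma> x \<in> V}"
  proof
    fix c assume "c \<in> S"
    then obtain V where V: "V \<in> \<V>" "c = W V" "x \<in> W V" by (auto simp: S_def C_def)
    then show "c \<in> W ` {V \<in> \<V>. \<sigma> x \<in> V}" using W_iff[OF V(1) x(1)] by auto
  qed
  then have "card S \<le> card {V \<in> \<V>. \<sigma> x \<in> V}"
    using \<V>(1) by (intro surj_card_le) auto
  then have "card S \<le> nat (n + 1)"
    using bspec[OF \<V>(5) \<sigma>_top[OF x(1)]] by linarith
  then have "card (Pow S) \<le> 2 ^ nat (n + 1)"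
    using fin_C by (simp add: card_Pow S_def)
  \<comment> \<open>\<open>g j x\<close> depends on \<open>j\<close> only through the subset of
    \<open>S\<close> that is summed, and the values \<open>y j\<close> are distinct.\<close>
  moreover have "inj_on (\<lambda>j. {c \<in> S. j \<in> e' c}) {..<N}"
  proof (rule inj_onI)
    fix j k assume jk: "j \<in> {..<N}" "k \<in> {..<N}" "{c \<in> S. j \<in> e' c} = {c \<in> S. k \<in> e' c}"
    have "g i x = (\<Sum>c\<in>{c \<in> S. i \<in> e' c}. \<phi> c x)" for i
      unfolding g_def S_def using fin_C \<phi>(2) x(1) by (intro sum.mono_neutral_cong_right) auto
    then have "g j x = g k x" using jk(3) by simp
    moreover have "g j x - y j = 0" "g k x - y k = 0" using x(2) jk(1,2) by simp_all
    ultimately have "y j = y k" by linarith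
    then show "j = k" by (rule y(3))
  qed
  then have "N \<le> card (Pow S)"
    using card_inj_on_le[of "\<lambda>j. {c \<in> S. j \<in> e' c}" "{..<N}" "Pow S"] fin_C by (auto simp: S_def)
  ultimately show False using N by linarith
qed

section \<open>Open sets of trees\<close>

definition class_packing_radius :: "nat \<Rightarrow> univ metric set \<Rightarrow> real" where
  "class_packing_radius k C = packing_radius k (SOME X. X \<in> C)"

lemma class_packing_radius_isometry_class:
  fixes m :: "'a metric"
  assumes "compact_space (mtopology_of m)"
  shows "class_packing_radius k (isometry_class m) = packing_radius k m"
proof -
  obtain m' :: "univ metric" where "isometric m m'"
    using compact_metric_isometric_copy[OF assms] by blast
  then have "isometric m (SOME X. X \<in> isometry_class m)"
    using someI[of "\<lambda>X. X \<in> isometry_class m" m'] by (simp add: isometry_class_def)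
  then show ?thesis
    unfolding class_packing_radius_def by (rule packing_radius_isometric[symmetric])
qed

text \<open>Packing radii are 2-Lipschitz for the Gromov--Hausdorff distance, so radius
  \<open>e / 4\<close> moves them by at most \<open>e / 2\<close>.\<close>

lemma continuous_map_class_packing_radius:
  assumes k: "2 \<le> k"
  shows "continuous_map GH_tree_topology euclideanreal (class_packing_radius k)"
  unfolding GH_tree_topology_def
proof (rule continuous_map_from_subtopology)
  have rep: "\<exists>m :: univ metric. C = isometry_class m \<and> mspace m \<noteq> {} \<and> compact_space (mtopology_of m)"
    if "C \<in> GH_space" for C
    using that by (auto simp: GH_space_def)
  have Lip: "\<bar>class_packing_radius k C - class_packing_radius k D\<bar> \<le> 2 * r"
    if CD: "C \<in> GH_space" "D \<in> GH_space" "GH_class_dist C D < r" for C D r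
  proof -
    obtain X Y :: "univ metric" where X: "C = isometry_class X" "mspace X \<noteq> {}" "compact_space (mtopology_of X)"
      and Y: "D = isometry_class Y" "mspace Y \<noteq> {}" "compact_space (mtopology_of Y)"
      using rep[OF CD(1)] rep[OF CD(2)] by blast
    show ?thesis
      using packing_radius_GH_Lipschitz[OF X(3) Y(3) X(2) Y(2) k, of r] CD(3)
      unfolding X(1) Y(1) class_packing_radius_isometry_class[OF X(3)]
        class_packing_radius_isometry_class[OF Y(3)] GH_class_dist_isometry_class by blast
  qed
  have top: "topspace GH_topology \<subseteq> GH_space"
    using openin_topspace[of GH_topology] unfolding openin_GH_topology by blast
  show "continuous_map GH_topology euclideanreal (class_packing_radius k)"
    unfolding continuous_map_def
  proof (intro conjI allI impI)
    fix V :: "real set" assume V: "openin euclideanreal V"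
    let ?P = "{C \<in> topspace GH_topology. class_packing_radius k C \<in> V}"
    show "openin GH_topology ?P"
      unfolding openin_GH_topology
    proof (intro conjI ballI)
      show "?P \<subseteq> GH_space" using top by blast
      fix C assume C: "C \<in> ?P"
      then have "open V" "class_packing_radius k C \<in> V" using V by auto
      then obtain e where e: "0 < e" "ball (class_packing_radius k C) e \<subseteq> V"
        by (rule openE)
      have "openin GH_topology GH_space"
        unfolding openin_GH_topology by (auto intro: exI[of _ 1])
      then have top': "GH_space \<subseteq> topspace GH_topology" by (rule openin_subset)
      show "\<exists>r>0. \<forall>D\<in>GH_space. GH_class_dist C D < r \<longrightarrow> D \<in> ?P"
      proof (intro exI[of _ "e / 4"] conjI ballI impI)
        fix D assume D: "D \<in> GH_space" "GH_class_dist C D < e / 4"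
        have "C \<in> GH_space" using C top by blast
        then have "\<bar>class_packing_radius k C - class_packing_radius k D\<bar> \<le> 2 * (e / 4)"
          using Lip D by blast
        then have "class_packing_radius k D \<in> ball (class_packing_radius k C) e"
          using e(1) by (simp add: dist_real_def)
        then show "D \<in> ?P" using e(2) D(1) top' by blast
      qed (use e(1) in simp)
    qed
  qed auto
qed

text \<open>Restated for metrics on the type of the stars over \<open>m\<close>, to which it will be
  applied.\<close>

lemma open_GH_trees_contains_near_trees:
  assumes U: "openin GH_tree_topology U" "U \<noteq> {}"
  obtains m :: "univ metric" and p e where "p \<in> mspace m" "compact_space (mtopology_of m)" "metric_tree m"
    "0 < e" "\<And>m' :: (univ + nat \<times> real) metric. compact_space (mtopology_of m') \<Longrightarrow> metric_tree m' \<Longrightarrow> mspace m' \<noteq> {} \<Longrightarrow>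
      GH_dist m m' < e \<Longrightarrow> isometry_class m' \<in> U"
proof -
  obtain V where V: "openin GH_topology V" "U = V \<inter> GH_trees"
    using U(1) by (auto simp: GH_tree_topology_def openin_subtopology)
  obtain C where C: "C \<in> U" using U(2) by blast
  then have "C \<in> GH_trees" using V by blast
  then obtain m :: "univ metric" where m: "C = isometry_class m" "mspace m \<noteq> {}"
    "compact_space (mtopology_of m)" "metric_tree m"
    unfolding GH_trees_def by blast
  obtain p where p: "p \<in> mspace m" using m(2) by blast
  have "C \<in> V" using C V(2) by blast
  then obtain e where e: "0 < e" "\<And>D. D \<in> GH_space \<Longrightarrow> GH_class_dist C D < e \<Longrightarrow> D \<in> V"
    using V(1) unfolding openin_GH_topology by meson
  show thesis
  proof (rule that[OF p m(3,4) e(1)])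
    fix m' :: "(univ + nat \<times> real) metric"
    assume m': "compact_space (mtopology_of m')" "metric_tree m'" "mspace m' \<noteq> {}" "GH_dist m m' < e"
    have "isometry_class m' \<in> GH_trees"
      using isometry_class_in_GH_trees[OF m'(3,1,2)] .
    moreover have "GH_class_dist C (isometry_class m') < e"
      using m'(4) GH_class_dist_isometry_class_compact[OF m(3) m'(1)] by (simp add: m(1))
    ultimately show "isometry_class m' \<in> U"
      using e(2) GH_trees_subset V(2) by blast
  qed
qed

text \<open>The cube is mapped into \<open>U\<close> by attaching to one tree of \<open>U\<close>
  legs whose lengths encode the coordinates; packing radii recover them.\<close>

lemma not_covering_dim_le_open_GH_trees:
  assumes U: "openin GH_tree_topology U" "U \<noteq> {}"
  shows "\<not> covering_dim_le (subtopology GH_tree_topology U) n"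
proof -
  obtain m :: "univ metric" and p e where p: "p \<in> mspace m" and c: "compact_space (mtopology_of m)"
    and tree: "metric_tree m" and e: "0 < e"
    and in_U: "\<And>m' :: (univ + nat \<times> real) metric. compact_space (mtopology_of m') \<Longrightarrow> metric_tree m' \<Longrightarrow>
      mspace m' \<noteq> {} \<Longrightarrow> GH_dist m m' < e \<Longrightarrow> isometry_class m' \<in> U"
    by (rule open_GH_trees_contains_near_trees[OF U]) (rule that)
  \<comment> \<open>Legs have length at most \<open>2 * h < e\<close>, which keeps the stars in
    \<open>U\<close>.\<close>
  define h where "h = e / 3"
  have h: "0 < h" "2 * h < e" using e by (auto simp: h_def)
  obtain P where P: "\<And>x. \<not> separated_tuple (Suc P) m h x"
    by (rule compact_space_packing_number[OF c h(1)]) (rule that)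
  define K where "K = P + 2"
  define N where "N = Suc (2 ^ nat (n + 1))"
  have N: "0 < N" by (simp add: N_def)
  \<comment> \<open>The interval from \<open>h\<close> to \<open>2 * h\<close> is cut into
    \<open>N\<close> equal slots in decreasing order, and \<open>a j\<close> is the position in slot
    \<open>j\<close>. The lengths are thus monotone for every \<open>a\<close> in the cube, as
    \<open>packing_radius_star\<close> demands.\<close>
  define l where "l a j = h * (1 + (real (N - Suc j) + a j) / real N)" for a :: "nat \<Rightarrow> real" and j
  have l: "h \<le> l a j \<and> l a j \<le> 2 * h" if "a \<in> cube N" "j < N" for a j
  proof -
    have "0 \<le> a j" "a j \<le> 1" using that by (auto simp: cube_def)
    then have "0 \<le> (real (N - Suc j) + a j) / real N" "(real (N - Suc j) + a j) / real N \<le> 1"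
      using that(2) by (auto simp: of_nat_diff divide_le_eq_1)
    then have "h * 1 \<le> h * (1 + (real (N - Suc j) + a j) / real N)"
      "h * (1 + (real (N - Suc j) + a j) / real N) \<le> h * 2"
      using h(1) by (intro mult_left_mono; simp)+
    then show ?thesis by (simp add: l_def)
  qed
  have mono: "l a j \<le> l a i" if "a \<in> cube N" "i \<le> j" "j < N" for a i j
  proof (cases "i = j")
    case False
    have "a j \<le> 1" "0 \<le> a i" using that by (auto simp: cube_def)
    then have "real (N - Suc j) + a j \<le> real (N - Suc i) + a i"
      using that False by (auto simp: of_nat_diff)
    then show ?thesis
      unfolding l_def using h(1) by (intro mult_left_mono add_left_mono divide_right_mono) auto
  qed simp
  define Y where "Y a = star m p (N * K) (\<lambda>i. l a (i div K))" for a
  have leg: "h \<le> l a (i div K) \<and> l a (i div K) \<le> 2 * h" if "a \<in> cube N" "i < N * K" for a i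
    using l[OF that(1)] that(2) by (simp add: less_mult_imp_div_less)
  have leg0: "0 < l a (i div K)" if "a \<in> cube N" "i < N * K" for a i
    using leg[OF that] h(1) by linarith
  have Y_compact: "compact_space (mtopology_of (Y a))" if "a \<in> cube N" for a
    unfolding Y_def by (rule compact_space_star[OF p leg0[OF that] c])
  have Y_tree: "metric_tree (Y a)" if "a \<in> cube N" for a
    unfolding Y_def by (rule metric_tree_star[OF p leg0[OF that] tree])
  have Y_ne: "mspace (Y a) \<noteq> {}" for a
    unfolding Y_def using p by (auto simp: mspace_star[OF p])
  have Y_cont: "\<exists>d>0. \<forall>b\<in>cube N. dist b a < d \<longrightarrow> GH_dist (Y a) (Y b) < r"
    if a: "a \<in> cube N" and r: "0 < r" for a r
  proof -
    have "\<exists>d>0. \<forall>b. dist b a < d \<longrightarrow> \<bar>a j - b j\<bar> < r / (2 * h)" for j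
    proof -
      have "isCont (\<lambda>b::nat \<Rightarrow> real. b j) a"
        by (rule continuous_on_interior[of UNIV]) (auto intro: continuous_on_product_coordinates)
      moreover have "0 < r / (2 * h)" using r h(1) by simp
      ultimately show ?thesis
        unfolding continuous_at_eps_delta by (fastforce simp: dist_real_def abs_minus_commute)
    qed
    then obtain d where d: "\<And>j. 0 < d j" "\<And>j b. dist b a < d j \<Longrightarrow> \<bar>a j - b j\<bar> < r / (2 * h)"
      by metis
    \<comment> \<open>Nearness in the product topology controls coordinates one at a time; only the
      first \<open>N\<close> occur in the lengths.\<close>
    define d0 where "d0 = Min (d ` {..<N})"
    have "{..<N} \<noteq> {}" using N by auto
    then have d0: "0 < d0" unfolding d0_def using d(1) by (subst Min_gr_iff) auto
    have "GH_dist (Y a) (Y b) < r" if b: "b \<in> cube N" "dist b a < d0" for b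
    proof -
      have near: "\<bar>l a j - l b j\<bar> \<le> r / 2" if j: "j < N" for j
      proof -
        have "d0 \<le> d j" using j by (auto simp: d0_def)
        then have "\<bar>a j - b j\<bar> < r / (2 * h)" using d(2) b(2) by auto
        then have *: "h * \<bar>a j - b j\<bar> \<le> r / 2" using h(1) by (simp add: field_simps)
        have "l a j - l b j = h * (a j - b j) / real N"
          by (simp add: l_def algebra_simps add_divide_distrib diff_divide_distrib)
        then have "\<bar>l a j - l b j\<bar> = h * \<bar>a j - b j\<bar> / real N"
          using h(1) by (simp add: abs_mult)
        also have "\<dots> \<le> h * \<bar>a j - b j\<bar> / 1"
          using N h(1) by (intro divide_left_mono) auto
        finally show ?thesis using * by simp
      qed
      have "GH_dist (Y a) (Y b) \<le> r / 2"
        unfolding Y_def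
      proof (rule GH_dist_star_le[OF p c leg0[OF a] leg0[OF b(1)]])
        show "\<bar>l a (i div K) - l b (i div K)\<bar> \<le> r / 2" if "i < N * K" for i
          using near that by (simp add: less_mult_imp_div_less)
      qed (use r in auto)
      then show ?thesis using r by simp
    qed
    then show ?thesis using d0 by blast
  qed
  have Y_U: "isometry_class (Y a) \<in> U" if "a \<in> cube N" for a
  proof (rule in_U[OF Y_compact[OF that] Y_tree[OF that] Y_ne])
    have "GH_dist m (Y a) \<le> 2 * h"
      unfolding Y_def
      by (rule GH_dist_star_attached_le[OF p c]) (use leg[OF that] leg0[OF that] h(1) in auto)
    then show "GH_dist m (Y a) < e" using h(2) by simp
  qed
  \<comment> \<open>Solves \<open>2 * l a j = r\<close> for \<open>a j\<close>, with the packing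
    radius in place of \<open>r\<close>.\<close>
  define F where "F j C = (class_packing_radius (Suc j * K) C / (2 * h) - 1) * real N - real (N - Suc j)" for j C
  show ?thesis
  proof (rule covering_dim_gt_cube_retract[where \<sigma> = "\<lambda>a. isometry_class (Y a)" and F = F and N = N])
    show "continuous_map (top_of_set (cube N)) (subtopology GH_tree_topology U) (\<lambda>a. isometry_class (Y a))"
      using GH_tree_topology_continuous_mapI[of "cube N" Y] Y_compact Y_ne Y_tree Y_cont Y_U
      by (auto simp: continuous_map_in_subtopology)
    show "continuous_map (subtopology GH_tree_topology U) euclideanreal (F j)" for j
    proof -
      have "continuous_map GH_tree_topology euclideanreal (class_packing_radius (Suc j * K))"
        by (rule continuous_map_class_packing_radius) (simp add: K_def)
      moreover have "continuous_map euclideanreal euclideanreal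
          (\<lambda>r. (r / (2 * h) - 1) * real N - real (N - Suc j))"
        using h(1) by (simp, intro continuous_intros) auto
      ultimately have "continuous_map GH_tree_topology euclideanreal
          ((\<lambda>r. (r / (2 * h) - 1) * real N - real (N - Suc j)) \<circ> class_packing_radius (Suc j * K))"
        by (rule continuous_map_compose)
      moreover have "(\<lambda>r. (r / (2 * h) - 1) * real N - real (N - Suc j)) \<circ> class_packing_radius (Suc j * K) = F j"
        by (simp add: F_def fun_eq_iff)
      ultimately show ?thesis
        by (intro continuous_map_from_subtopology) simp
    qed
    show "F j (isometry_class (Y a)) = a j" if "j < N" "a \<in> cube N" for j a
    proof -
      have "class_packing_radius (Suc j * K) (isometry_class (Y a)) = packing_radius (Suc j * K) (Y a)"
        by (rule class_packing_radius_isometry_class[OF Y_compact[OF that(2)]])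
      also have "\<dots> = 2 * l a j"
        unfolding Y_def
        by (rule packing_radius_star[OF p c P K_def h(1) l[OF that(2)] mono[OF that(2)] that(1)])
      finally have "class_packing_radius (Suc j * K) (isometry_class (Y a)) = 2 * l a j" .
      then show ?thesis
        using h(1) N by (simp add: F_def l_def)
    qed
    show "2 ^ nat (n + 1) < N" by (simp add: N_def)
  qed
qed

theorem corollary1p2:
  shows "path_connected_space GH_tree_topology \<and>
         (\<forall>U. openin GH_tree_topology U \<and> U \<noteq> {} \<longrightarrow>
              covering_dim (subtopology GH_tree_topology U) = \<infinity>)"
proof (intro conjI allI impI)
  show "path_connected_space GH_tree_topology"
    by (rule path_connected_space_GH_tree_topology)
  fix U assume "openin GH_tree_topology U \<and> U \<noteq> {}"
  \<comment> \<open>No integer bounds the dimension, and the infimum of the empty set in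
    \<open>ereal\<close> is infinite.\<close>
  then have "{n. - 1 \<le> n \<and> covering_dim_le (subtopology GH_tree_topology U) n} = {}"
    using not_covering_dim_le_open_GH_trees by simp
  then show "covering_dim (subtopology GH_tree_topology U) = \<infinity>"
    by (simp only: covering_dim_def) (simp add: top_ereal_def)
qed

end
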